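(* Let $d\ge 2$, and let ${\mathcal E},{\mathcal O}$ be the even and odd vertices of ${\mathbb Z}^d$. Let $\chi(0,{\mathcal O})$ be any proper $3$-coloring of ${\mathbb Z}^d$ with $\chi(0,{\mathcal O})\equiv 0$ on ${\mathcal O}$. For $m\in{\mathbb N}$ let $W_m$ be the box $\{-m,\ldots,m\}^d$ together with all odd vertices of $\{-(m+1),\ldots,m+1\}^d$, and let $\mu_m$ be the uniform measure on proper $3$-colorings of ${\mathbb Z}^d$ agreeing with $\chi(0,{\mathcal O})$ outside $W_m$. Let $\mu^{(0,{\mathcal O})}$ be any subsequential weak limit of $(\mu_m)$. Then $\mu^{(0,{\mathcal O})}$ is a measure of maximal entropy for the set ${\mathcal C}_3$ of proper $3$-colorings of ${\mathbb Z}^d$, i.e. ${\mathcal H}^{\mu^{(0,{\mathcal O})}}({\mathcal C}_3)={\mathcal H}^{\rm topo}({\mathcal C}_3)$.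
   Context: For a random variable $X$ with finite range taking value $x$ with probability $p(x)$, its entropy is $H(X)=-\sum_x p(x)\log p(x)$. Let $\Lambda_n=\{-n,\ldots,n\}^d$ and let ${\mathcal C}'_3(\Lambda_n)$ be the set of proper $3$-colorings of $\Lambda_n$ (induced subgraph) that extend to a proper $3$-coloring of ${\mathbb Z}^d$. The topological entropy is ${\mathcal H}^{\rm topo}({\mathcal C}_3)=\lim_{n\to\infty}\log|{\mathcal C}'_3(\Lambda_n)|/|\Lambda_n|$. For a probability measure $\mu$ on ${\mathcal C}_3$ (with the $\sigma$-algebra generated by cylinder events $\{\chi(v)=i\}$), letting $X_n$ be the restriction to $\Lambda_n$ of a $\mu$-random coloring, the measure-theoretic entropy is ${\mathcal H}^{\mu}({\mathcal C}_3)=\lim_{n\to\infty}H(X_n)/|\Lambda_n|$. A measure $\mu$ is of maximal entropy if ${\mathcal H}^{\mu}({\mathcal C}_3)={\mathcal H}^{\rm topo}({\mathcal C}_3)$. *)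

theory Defs
  imports "HOL-Probability.Probability"
begin

text \<open>The lattice of dimension \<open>d = CARD('d)\<close> is the type \<open>int ^ 'd\<close>, with nearest-neighbour
  adjacency (\<open>\<ell>\<^sup>1\<close>-distance one).\<close>

definition adjacent :: "int ^ 'd \<Rightarrow> int ^ 'd \<Rightarrow> bool" where
  "adjacent u v \<longleftrightarrow> (\<Sum>i\<in>UNIV. \<bar>u $ i - v $ i\<bar>) = 1"

definition odd_vertices :: "(int ^ 'd) set" where
  "odd_vertices = {v. odd (\<Sum>i\<in>UNIV. v $ i)}"

definition lattice_box :: "nat \<Rightarrow> (int ^ 'd) set" where
  "lattice_box n = {v. \<forall>i. v $ i \<in> {- int n..int n}}"

text \<open>Proper 3-colorings of the subgraph induced on \<open>S\<close>. They are extensional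
  (\<open>undefined\<close> off \<open>S\<close>), so that they can be counted as functions on \<open>S\<close>.\<close>

definition proper_colorings :: "(int ^ 'd) set \<Rightarrow> (int ^ 'd \<Rightarrow> nat) set" where
  "proper_colorings S =
     {c \<in> S \<rightarrow>\<^sub>E {0, 1, 2}. \<forall>u\<in>S. \<forall>v\<in>S. adjacent u v \<longrightarrow> c u \<noteq> c v}"

definition C3 :: "(int ^ 'd \<Rightarrow> nat) set" where
  "C3 = proper_colorings UNIV"

definition extendable_colorings :: "(int ^ 'd) set \<Rightarrow> (int ^ 'd \<Rightarrow> nat) set" where
  "extendable_colorings S = {c \<in> proper_colorings S. \<exists>\<psi>\<in>C3. \<forall>v\<in>S. \<psi> v = c v}"

definition coloring_space :: "(int ^ 'd \<Rightarrow> nat) measure" where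
  "coloring_space = sigma C3 {{c \<in> C3. c v = i} | v i. i \<in> {0, 1, 2}}"

definition topo_entropy_seq :: "'d::finite itself \<Rightarrow> nat \<Rightarrow> real" where
  "topo_entropy_seq _ n =
     ln (real (card (extendable_colorings (lattice_box n :: (int ^ 'd) set))))
       / real (card (lattice_box n :: (int ^ 'd) set))"

definition topo_entropy :: "'d::finite itself \<Rightarrow> real" where
  "topo_entropy d = lim (topo_entropy_seq d)"

text \<open>Entropy of a random variable with finite range, in nats. Since \<open>0 * ln 0 = 0\<close>,
  values of probability zero do not contribute.\<close>

definition shannon_entropy :: "'a measure \<Rightarrow> ('a \<Rightarrow> 'b) \<Rightarrow> real" where
  "shannon_entropy M X =
     - (\<Sum>x\<in>X ` space M. let p = measure M (X -` {x} \<inter> space M) in p * ln p)"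

lemma (in prob_space) shannon_entropy_eq_entropy:
  assumes "simple_function M X"
  shows "shannon_entropy M X = entropy (exp 1) (count_space (X ` space M)) X"
proof -
  interpret information_space M "exp 1"
    by unfold_locales auto
  have "simple_distributed M X (\<lambda>x. prob (X -` {x} \<inter> space M))"
    using assms by (intro simple_distributedI) auto
  from entropy_simple_distributed[OF this] show ?thesis
    by (simp add: shannon_entropy_def log_def Let_def)
qed

definition measure_entropy_seq :: "(int ^ 'd \<Rightarrow> nat) measure \<Rightarrow> nat \<Rightarrow> real" where
  "measure_entropy_seq \<mu> n =
     shannon_entropy \<mu> (\<lambda>c. restrict c (lattice_box n)) / real (card (lattice_box n :: (int ^ 'd) set))"

definition measure_entropy :: "(int ^ 'd \<Rightarrow> nat) measure \<Rightarrow> real" where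
  "measure_entropy \<mu> = lim (measure_entropy_seq \<mu>)"

text \<open>\<^const>\<open>lim\<close> is unspecified on divergent sequences, so the existence of both limits is
  required explicitly.\<close>

definition maximal_entropy :: "(int ^ 'd::finite \<Rightarrow> nat) measure \<Rightarrow> bool" where
  "maximal_entropy \<mu> \<longleftrightarrow>
     convergent (topo_entropy_seq TYPE('d)) \<and> convergent (measure_entropy_seq \<mu>) \<and>
     measure_entropy \<mu> = topo_entropy TYPE('d)"

definition W :: "nat \<Rightarrow> (int ^ 'd) set" where
  "W m = lattice_box m \<union> (odd_vertices \<inter> lattice_box (m + 1))"

definition boundary_colorings :: "(int ^ 'd \<Rightarrow> nat) \<Rightarrow> nat \<Rightarrow> (int ^ 'd \<Rightarrow> nat) set" where
  "boundary_colorings c\<^sub>0 m = {c \<in> C3. \<forall>v. v \<notin> W m \<longrightarrow> c v = c\<^sub>0 v}"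

text \<open>The library's uniform measure on a finite set lives on that set with its power set as
  \<open>\<sigma>\<close>-algebra; \<^const>\<open>distr\<close> along the inclusion makes it a measure on the space of
  all colorings.\<close>

definition boundary_measure :: "(int ^ 'd \<Rightarrow> nat) \<Rightarrow> nat \<Rightarrow> (int ^ 'd \<Rightarrow> nat) measure" where
  "boundary_measure c\<^sub>0 m =
     distr (uniform_count_measure (boundary_colorings c\<^sub>0 m)) coloring_space (\<lambda>c. c)"

text \<open>Weak convergence on \<^const>\<open>C3\<close>, whose topology is induced by the product topology on
  functions into the discrete space \<^typ>\<open>nat\<close>.\<close>

definition weakly_converges ::
    "(nat \<Rightarrow> (int ^ 'd \<Rightarrow> nat) measure) \<Rightarrow> (int ^ 'd \<Rightarrow> nat) measure \<Rightarrow> bool" where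
  "weakly_converges \<mu>s \<mu> \<longleftrightarrow>
     (\<forall>f :: (int ^ 'd \<Rightarrow> nat) \<Rightarrow> real. continuous_on C3 f \<longrightarrow> bounded (f ` C3) \<longrightarrow>
       (\<lambda>k. integral\<^sup>L (\<mu>s k) f) \<longlonglongrightarrow> integral\<^sup>L \<mu> f)"

definition subsequential_weak_limit ::
    "(nat \<Rightarrow> (int ^ 'd \<Rightarrow> nat) measure) \<Rightarrow> (int ^ 'd \<Rightarrow> nat) measure \<Rightarrow> bool" where
  "subsequential_weak_limit \<mu>s \<mu> \<longleftrightarrow>
     prob_space \<mu> \<and> sets \<mu> = sets coloring_space \<and>
     (\<exists>r. strict_mono r \<and> weakly_converges (\<mu>s \<circ> r) \<mu>)"

end

theory Submission
  imports Defs
begin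

text \<open>Proper 3-colorings are the reductions modulo 3 of height functions, integer functions that
  change by one along every edge. Swapping two height functions on a cluster of their disagreement
  set shows that the mean height is monotone in the boundary values, hence that the conditional mean
  of one height given another is increasing and 1-Lipschitz. This bounds the variance of a height
  difference by a multiple of the distance, uniformly in the domain; the means are controlled by the
  reflection \<open>h \<mapsto> 6 - h\<close>. By Markov's inequality a typical height function under \<open>\<mu>\<^sub>m\<close> therefore
  oscillates by at most \<open>\<epsilon> n\<close> on the box of radius \<open>n\<close>.

  Given such a height function outside the box, the Lipschitz extension property allows any flat
  height function to be inserted in a slightly smaller box. Flat ones are plentiful: by the
  pigeonhole principle, up to a factor of surface order all height functions on a box of fixed radius
  \<open>k\<close> share their boundary values, and such pieces can be placed independently into a tiling by
  reflected boxes. Hence the conditional entropy of the box given its complement is at least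
  \<open>(1 - \<epsilon>)\<close> times the entropy density of radius \<open>k\<close>, uniformly in \<open>m\<close>, which passes to the weak limit.\<close>

subsection \<open>The lattice\<close>

text \<open>Uniformly in \<open>m\<close> only a second moment linear in the distance is at hand, so
  a union bound over the n^d sites of a box fails. The Lipschitz property rescues the estimate: one
  exceptional site spoils a whole subbox of comparable radius, and a single Markov estimate for the
  sum of squares over the box suffices. The reflection constant comes from the boundary condition:
  odd sites carry color 0 and odd heights, so they can be lifted to 3 and the even sites to 2 or 4;
  \<open>6 - h\<close> is the reflection in 3. Dimension at least two enters through the
  connectedness of the complement of \<open>W m\<close>: colors there fix the heights up to one
  additive constant, so uniform colorings are images of uniform height functions with fixed boundary
  values. Conditioning on the complement turns entropy into counting, since the conditional law in
  the box is uniform on its fillings. Comparing the resulting lower bound with the logarithm of the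
  number of patterns gives existence and equality of both limits at once.\<close>

definition l1 :: "int ^ 'd::finite \<Rightarrow> int ^ 'd \<Rightarrow> int" where
  "l1 x y = (\<Sum>i\<in>UNIV. \<bar>x $ i - y $ i\<bar>)"

definition csum :: "int ^ 'd::finite \<Rightarrow> int" where
  "csum x = (\<Sum>i\<in>UNIV. x $ i)"

definition upd :: "int ^ 'd::finite \<Rightarrow> 'd \<Rightarrow> int \<Rightarrow> int ^ 'd" where
  "upd x i a = (\<chi> j. if j = i then a else x $ j)"

lemma upd_nth [simp]: "upd x i a $ j = (if j = i then a else x $ j)"
  by (simp add: upd_def)

lemma upd_same [simp]: "upd x i (x $ i) = x"
  by (simp add: vec_eq_iff)

lemma upd_upd [simp]: "upd (upd x i a) i b = upd x i b"
  by (simp add: vec_eq_iff)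

lemma adjacent_iff_l1: "adjacent x y \<longleftrightarrow> l1 x y = 1"
  by (simp add: adjacent_def l1_def)

lemma l1_refl [simp]: "l1 x x = 0"
  by (simp add: l1_def)

lemma l1_nonneg [simp]: "0 \<le> l1 x y"
  by (simp add: l1_def sum_nonneg)

lemma l1_commute: "l1 x y = l1 y x"
  by (simp add: l1_def abs_minus_commute)

lemma l1_triangle: "l1 x z \<le> l1 x y + l1 y z"
  unfolding l1_def sum.distrib[symmetric] by (rule sum_mono) auto

lemma l1_upd: "l1 (upd x i a) y = l1 x y - \<bar>x $ i - y $ i\<bar> + \<bar>a - y $ i\<bar>"
proof -
  have "l1 z y = \<bar>z $ i - y $ i\<bar> + (\<Sum>j\<in>UNIV-{i}. \<bar>z $ j - y $ j\<bar>)" for z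
    unfolding l1_def by (rule sum.remove) auto
  from this[of x] this[of "upd x i a"] show ?thesis
    by (simp cong: sum.cong_simp)
qed

lemma l1_upd_same: "l1 x (upd x i a) = \<bar>a - x $ i\<bar>"
  using l1_upd[of x i a x] by (simp add: l1_commute)

lemma adjacent_upd: "\<bar>a - x $ i\<bar> = 1 \<Longrightarrow> adjacent x (upd x i a)"
  by (simp add: adjacent_iff_l1 l1_upd_same)

lemma adjacent_commute: "adjacent x y \<longleftrightarrow> adjacent y x"
  by (simp add: adjacent_iff_l1 l1_commute)

lemma l1_parity: "even (l1 x y) \<longleftrightarrow> even (csum x - csum y)"
proof -
  have "even (\<Sum>i\<in>A. \<bar>x $ i - y $ i\<bar>) \<longleftrightarrow> even (\<Sum>i\<in>A. x $ i - y $ i)" if "finite A" for A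
    using that by (induction A) auto
  from this[of UNIV] show ?thesis
    by (simp add: l1_def csum_def sum_subtractf)
qed

lemma l1_eq_0_iff: "l1 x y = 0 \<longleftrightarrow> x = y"
  unfolding l1_def by (subst sum_nonneg_eq_0_iff) (auto simp: vec_eq_iff)

lemma l1_step:
  assumes "x \<noteq> y"
  obtains z where "adjacent x z" "l1 x y = l1 z y + 1"
proof -
  obtain i where i: "x $ i \<noteq> y $ i" using assms by (auto simp: vec_eq_iff)
  define z where "z = upd x i (x $ i + sgn (y $ i - x $ i))"
  have "adjacent x z" unfolding z_def using i by (intro adjacent_upd) (auto simp: sgn_if)
  moreover have "l1 x y = l1 z y + 1"
    unfolding z_def l1_upd using i by (auto simp: sgn_if)
  ultimately show ?thesis by (rule that)
qed

lemma l1_induct: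
  assumes "\<And>x. P x x"
    and "\<And>x z y. adjacent x z \<Longrightarrow> l1 x y = l1 z y + 1 \<Longrightarrow> P z y \<Longrightarrow> P x y"
  shows "P x y"
proof (induction "nat (l1 x y)" arbitrary: x)
  case 0
  then have "x = y" using l1_nonneg[of x y] by (simp add: l1_eq_0_iff)
  then show ?case using assms(1) by simp
next
  case (Suc n)
  then have "x \<noteq> y" by auto
  then obtain z where z: "adjacent x z" "l1 x y = l1 z y + 1" by (rule l1_step)
  then show ?case using Suc assms(2) by auto
qed

lemma adjacentE:
  assumes "adjacent x y"
  obtains i where "y = upd x i (y $ i)" "\<bar>y $ i - x $ i\<bar> = 1"
proof -
  have s: "l1 x y = 1" using assms by (simp add: adjacent_iff_l1)
  then have "x \<noteq> y" by auto
  then obtain i where i: "x $ i \<noteq> y $ i" by (auto simp: vec_eq_iff)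
  have "l1 (upd x i (y $ i)) y = 1 - \<bar>x $ i - y $ i\<bar>" using l1_upd[of x i "y $ i" y] s by simp
  moreover have "\<bar>x $ i - y $ i\<bar> \<ge> 1" using i by simp
  ultimately have "\<bar>x $ i - y $ i\<bar> = 1" "l1 (upd x i (y $ i)) y = 0"
    using l1_nonneg[of "upd x i (y $ i)" y] by linarith+
  then show ?thesis using that[of i] by (simp add: l1_eq_0_iff abs_minus_commute)
qed

lemma lattice_box_iff: "x \<in> lattice_box n \<longleftrightarrow> (\<forall>i. \<bar>x $ i\<bar> \<le> int n)"
  by (auto simp: lattice_box_def abs_le_iff minus_le_iff)

lemma card_int_cube:
  fixes a b :: int
  shows "finite {x :: int ^ 'd::finite. \<forall>i. x $ i \<in> {a..b}}"
    and "card {x :: int ^ 'd::finite. \<forall>i. x $ i \<in> {a..b}} = nat (b - a + 1) ^ CARD('d)"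
proof -
  let ?S = "{x :: int ^ 'd. \<forall>i. x $ i \<in> {a..b}}"
  have "bij_betw vec_nth ?S (UNIV \<rightarrow>\<^sub>E {a..b})"
    by (rule bij_betw_byWitness[where f' = vec_lambda]) (auto simp: PiE_def Pi_def extensional_def)
  then have "finite ?S = finite ((UNIV :: 'd set) \<rightarrow>\<^sub>E {a..b})"
    "card ?S = card ((UNIV :: 'd set) \<rightarrow>\<^sub>E {a..b})"
    by (rule bij_betw_finite, rule bij_betw_same_card)
  then show "finite ?S" "card ?S = nat (b - a + 1) ^ CARD('d)"
    by (simp_all add: card_PiE finite_PiE)
qed

lemma finite_lattice_box [simp]: "finite (lattice_box n)"
  unfolding lattice_box_def by (rule card_int_cube)

lemma card_lattice_box: "card (lattice_box n :: (int ^ 'd::finite) set) = (2 * n + 1) ^ CARD('d)"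
proof -
  have "nat (int n - - int n + 1) = 2 * n + 1" by simp
  then show ?thesis unfolding lattice_box_def card_int_cube by (simp only:)
qed

lemma zero_mem_lattice_box [simp]: "0 \<in> lattice_box n"
  by (simp add: lattice_box_iff)

lemma l1_0_le_lattice_box: 
  fixes x :: "int ^ 'd::finite"
  assumes "x \<in> lattice_box n"
  shows "l1 x 0 \<le> int (CARD('d) * n)"
proof -
  have "l1 x 0 \<le> (\<Sum>i\<in>(UNIV :: 'd set). int n)"
    unfolding l1_def using assms by (intro sum_mono) (auto simp: lattice_box_iff)
  then show ?thesis by simp
qed

definition box_boundary :: "nat \<Rightarrow> (int ^ 'd::finite) set" where
  "box_boundary n = {x \<in> lattice_box n. \<exists>i. \<bar>x $ i\<bar> = int n}"

lemma finite_box_boundary [simp]: "finite (box_boundary n)"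
  by (simp add: box_boundary_def)

lemma card_box_boundary_le:
  "card (box_boundary n :: (int ^ 'd::finite) set) \<le> 2 * CARD('d) * (2 * n + 1) ^ (CARD('d) - 1)"
proof -
  let ?d = "CARD('d)"
  have face: "card {x :: int ^ 'd. x \<in> lattice_box n \<and> x $ i = a} \<le> (2 * n + 1) ^ (?d - 1)"
    (is "card ?S \<le> _") for i a
  proof -
    let ?f = "\<lambda>x :: int ^ 'd. \<lambda>j\<in>UNIV - {i}. x $ j"
    have "inj_on ?f ?S"
    proof (rule inj_onI)
      fix x y assume xy: "x \<in> ?S" "y \<in> ?S" "?f x = ?f y"
      have "x $ j = y $ j" for j
        using fun_cong[OF xy(3), of j] xy(1,2) by (cases "j = i") auto
      then show "x = y" by (simp add: vec_eq_iff)
    qed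
    moreover have "?f ` ?S \<subseteq> (UNIV - {i}) \<rightarrow>\<^sub>E {- int n..int n}"
      unfolding lattice_box_def by (intro image_subsetI restrict_PiE_iff[THEN iffD2]) blast
    moreover have "finite ((UNIV - {i}) \<rightarrow>\<^sub>E {- int n..int n})"
      by (intro finite_PiE) auto
    ultimately have "card ?S \<le> card ((UNIV - {i}) \<rightarrow>\<^sub>E {- int n..int n})"
      by (rule card_inj_on_le)
    also have "\<dots> = card {- int n..int n} ^ (?d - 1)"
      by (subst card_PiE) (simp_all add: card_Diff_singleton)
    also have "card {- int n..int n} = 2 * n + 1" by simp
    finally show ?thesis .
  qed
  have "\<bar>a\<bar> = int n \<longleftrightarrow> a = int n \<or> a = - int n" for a by linarith
  then have "box_boundary n = (\<Union>(i, a)\<in>(UNIV :: 'd set) \<times> {int n, - int n}. {x \<in> lattice_box n. x $ i = a})"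
    by (auto simp: box_boundary_def)
  then have "card (box_boundary n :: (int ^ 'd) set) \<le>
    (\<Sum>(i, a)\<in>(UNIV :: 'd set) \<times> {int n, - int n}. card {x :: int ^ 'd. x \<in> lattice_box n \<and> x $ i = a})"
    using card_UN_le[of "(UNIV :: 'd set) \<times> {int n, - int n}" "\<lambda>(i, a). {x :: int ^ 'd. x \<in> lattice_box n \<and> x $ i = a}"]
    by (simp add: case_prod_unfold)
  also have "\<dots> \<le> (\<Sum>(i, a)\<in>(UNIV :: 'd set) \<times> {int n, - int n}. (2 * n + 1) ^ (?d - 1))"
    by (intro sum_mono) (use face in \<open>auto simp: case_prod_unfold\<close>)
  also have "\<dots> = ?d * card {int n, - int n} * (2 * n + 1) ^ (?d - 1)"
    by (simp add: case_prod_unfold card_cartesian_product)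
  \<comment> \<open>The two faces of a direction coincide when \<open>n = 0\<close>, so their number
    is only bounded by 2.\<close>
  also have "\<dots> \<le> ?d * 2 * (2 * n + 1) ^ (?d - 1)"
    by (intro mult_right_mono mult_left_mono) (auto intro: order.trans[OF card_insert_le_m1])
  finally show ?thesis by (simp add: mult_ac)
qed

subsection \<open>Height functions\<close>

text \<open>Parity turns the bound 1 on increments into increments of exactly 1
  (\<open>heights_adjacent\<close>), while the condition on edges stays a Lipschitz condition. It
  also makes any two height functions differ by even numbers, on which the cluster argument and the
  lifts rely.\<close>

definition heights :: "(int ^ 'd::finite \<Rightarrow> int) set" where
  "heights = {h. (\<forall>u v. adjacent u v \<longrightarrow> \<bar>h u - h v\<bar> \<le> 1) \<and> (\<forall>v. even (h v - csum v))}"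

lemma heights_parity: "h \<in> heights \<Longrightarrow> even (h v - csum v)"
  by (simp add: heights_def)

lemma heights_even_diff: "h \<in> heights \<Longrightarrow> h' \<in> heights \<Longrightarrow> even (h v - h' v)"
  using heights_parity[of h v] heights_parity[of h' v] by presburger

lemma heights_adjacent:
  assumes "h \<in> heights" "adjacent u v"
  shows "\<bar>h u - h v\<bar> = 1"
proof -
  have "odd (csum u - csum v)" using l1_parity[of u v] assms(2) by (simp add: adjacent_iff_l1)
  then have "odd (h u - h v)" using heights_parity[OF assms(1), of u] heights_parity[OF assms(1), of v]
    by presburger
  moreover have "\<bar>h u - h v\<bar> \<le> 1" using assms by (simp add: heights_def)
  ultimately show ?thesis by presburger
qed

lemma heights_lipschitz:
  assumes "h \<in> heights"
  shows "\<bar>h x - h y\<bar> \<le> l1 x y"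
proof (induction rule: l1_induct)
  case (2 x z y)
  then show ?case using heights_adjacent[OF assms 2(1)] by linarith
qed simp

text \<open>McShane extension: \<open>F x\<close> is the supremum of \<open>f z - l1 x z\<close>
  over \<open>z\<close> in \<open>A\<close>. The set may be infinite; it will be the core of a box
  together with the outside of a larger one.\<close>

lemma heights_extend:
  fixes A :: "(int ^ 'd::finite) set"
  assumes "A \<noteq> {}" and par: "\<And>x. x \<in> A \<Longrightarrow> even (f x - csum x)"
    and lip: "\<And>x y. x \<in> A \<Longrightarrow> y \<in> A \<Longrightarrow> f x - f y \<le> l1 x y"
  obtains F where "F \<in> heights" "\<And>x. x \<in> A \<Longrightarrow> F x = f x"
proof -
  obtain a where a: "a \<in> A" using assms(1) by auto
  have "\<exists>y. y \<in> A \<and> (\<forall>z\<in>A. f z - l1 x z \<le> f y - l1 x y)" for x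
  proof -
    have bd: "f z - l1 x z \<le> f a + l1 x a" if "z \<in> A" for z
      using lip[OF that a] l1_triangle[of z a x] l1_triangle[of z x a] by (simp add: l1_commute)
    \<comment> \<open>The supremum is attained because the gap to the upper bound
      \<open>f a + l1 x a\<close> is a natural number; attainment is what gives \<open>F\<close> the
      right parity.\<close>
    have "\<exists>y. y \<in> A \<and> (\<forall>z. z \<in> A \<longrightarrow>
      nat (f a + l1 x a - (f y - l1 x y)) \<le> nat (f a + l1 x a - (f z - l1 x z)))"
      using ex_has_least_nat[of "\<lambda>y. y \<in> A" a "\<lambda>y. nat (f a + l1 x a - (f y - l1 x y))"] a by simp
    then obtain y where y: "y \<in> A" "\<And>z. z \<in> A \<Longrightarrow>
      nat (f a + l1 x a - (f y - l1 x y)) \<le> nat (f a + l1 x a - (f z - l1 x z))" by blast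
    have "f z - l1 x z \<le> f y - l1 x y" if "z \<in> A" for z
      using y(2)[OF that] bd[OF that] bd[OF y(1)] by linarith
    then show ?thesis using y(1) by blast
  qed
  then obtain m where m: "\<And>x. m x \<in> A" "\<And>x z. z \<in> A \<Longrightarrow> f z - l1 x z \<le> f (m x) - l1 x (m x)"
    by metis
  define F :: "int ^ 'd \<Rightarrow> int" where "F x = f (m x) - l1 x (m x)" for x
  have lipF: "F x - F y \<le> l1 x y" for x y
    using m(2)[OF m(1)[of x], of y] l1_triangle[of y "m x" x] unfolding F_def by (simp add: l1_commute)
  have "F \<in> heights" unfolding heights_def
  proof (intro CollectI conjI allI impI)
    fix u v :: "int ^ 'd" assume "adjacent u v"
    then show "\<bar>F u - F v\<bar> \<le> 1"
      using lipF[of u v] lipF[of v u] by (simp add: adjacent_iff_l1 l1_commute)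
  next
    fix v show "even (F v - csum v)"
      using par[OF m(1)[of v]] l1_parity[of v "m v"] unfolding F_def by presburger
  qed
  moreover have "F x = f x" if "x \<in> A" for x
    using m(2)[OF that, of x] lip[OF m(1)[of x] that] by (simp add: F_def l1_commute)
  ultimately show ?thesis by (rule that)
qed

subsection \<open>Averages over finite sets\<close>

definition mean :: "'a set \<Rightarrow> ('a \<Rightarrow> real) \<Rightarrow> real" where
  "mean S f = (\<Sum>x\<in>S. f x) / real (card S)"

text \<open>Covariance written through two independent copies: no mean appears, so sign and
  comparison statements reduce to pointwise inequalities between pairs of samples.\<close>

definition cov :: "'a set \<Rightarrow> ('a \<Rightarrow> real) \<Rightarrow> ('a \<Rightarrow> real) \<Rightarrow> real" where
  "cov S f g = (\<Sum>x\<in>S. \<Sum>y\<in>S. (f x - f y) * (g x - g y)) / (2 * (real (card S))\<^sup>2)"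

text \<open>The conditional expectation of \<open>f\<close> given \<open>X\<close> for the uniform
  law on \<open>S\<close>, as a function of the sample.\<close>

definition condmean :: "'a set \<Rightarrow> ('a \<Rightarrow> 'b) \<Rightarrow> ('a \<Rightarrow> real) \<Rightarrow> 'a \<Rightarrow> real" where
  "condmean S X f x = mean {y \<in> S. X y = X x} f"

lemma mean_add: "mean S (\<lambda>x. f x + g x) = mean S f + mean S g"
  by (simp add: mean_def sum.distrib add_divide_distrib)

lemma mean_diff: "mean S (\<lambda>x. f x - g x) = mean S f - mean S g"
  by (simp add: mean_def sum_subtractf diff_divide_distrib)

lemma mean_cmult: "mean S (\<lambda>x. c * f x) = c * mean S f"
  by (simp add: mean_def sum_distrib_left[symmetric])

lemma mean_const: "finite S \<Longrightarrow> S \<noteq> {} \<Longrightarrow> mean S (\<lambda>x. c) = c"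
  by (simp add: mean_def)

lemma mean_cong: "(\<And>x. x \<in> S \<Longrightarrow> f x = g x) \<Longrightarrow> mean S f = mean S g"
  unfolding mean_def by (simp cong: sum.cong)

lemma mean_mono: "(\<And>x. x \<in> S \<Longrightarrow> f x \<le> g x) \<Longrightarrow> mean S f \<le> mean S g"
  unfolding mean_def by (intro divide_right_mono sum_mono) auto

lemma mean_reindex: "bij_betw F S T \<Longrightarrow> mean T f = mean S (\<lambda>x. f (F x))"
  unfolding mean_def using sum.reindex_bij_betw[of F S T f] bij_betw_same_card[of F S T] by simp

lemma cov_eq:
  assumes "finite S" "S \<noteq> {}"
  shows "cov S f g = mean S (\<lambda>x. f x * g x) - mean S f * mean S g"
proof -
  let ?N = "real (card S)"
  have N: "?N \<noteq> 0" using assms by simp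
  have "(\<Sum>x\<in>S. \<Sum>y\<in>S. (f x - f y) * (g x - g y))
    = (\<Sum>x\<in>S. \<Sum>y\<in>S. f x * g x + f y * g y - f x * g y - f y * g x)"
    by (simp add: algebra_simps)
  also have "\<dots> = 2 * ?N * (\<Sum>x\<in>S. f x * g x) - 2 * (\<Sum>x\<in>S. f x) * (\<Sum>x\<in>S. g x)"
    by (simp add: sum.distrib sum_subtractf sum_distrib_left[symmetric] sum_distrib_right[symmetric])
  finally show ?thesis using N unfolding cov_def mean_def
    by (simp add: field_simps power2_eq_square)
qed

lemma cov_commute: "cov S f g = cov S g f"
  by (simp add: cov_def mult.commute)

lemma cov_diff_right: "cov S f (\<lambda>x. g x - h x) = cov S f g - cov S f h"
proof -
  have "(\<Sum>x\<in>S. \<Sum>y\<in>S. (f x - f y) * ((g x - h x) - (g y - h y)))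
    = (\<Sum>x\<in>S. \<Sum>y\<in>S. (f x - f y) * (g x - g y)) - (\<Sum>x\<in>S. \<Sum>y\<in>S. (f x - f y) * (h x - h y))"
    by (simp add: sum_subtractf[symmetric] algebra_simps)
  then show ?thesis by (simp add: cov_def diff_divide_distrib)
qed

lemma cov_mono:
  assumes "\<And>x y. x \<in> S \<Longrightarrow> y \<in> S \<Longrightarrow> (f x - f y) * (g x - g y) \<le> (h x - h y) * (k x - k y)"
  shows "cov S f g \<le> cov S h k"
  unfolding cov_def by (intro divide_right_mono sum_mono assms) simp_all

lemma cov_nonneg:
  assumes "\<And>x y. x \<in> S \<Longrightarrow> y \<in> S \<Longrightarrow> 0 \<le> (f x - f y) * (g x - g y)"
  shows "0 \<le> cov S f g"
  unfolding cov_def by (intro divide_nonneg_nonneg sum_nonneg assms) simp_all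

lemma cov_eq_0:
  assumes "\<And>x y. x \<in> S \<Longrightarrow> y \<in> S \<Longrightarrow> f x = f y"
  shows "cov S f g = 0"
proof -
  have "(\<Sum>x\<in>S. \<Sum>y\<in>S. (f x - f y) * (g x - g y)) = (\<Sum>x\<in>S. \<Sum>y\<in>S. 0)"
    by (intro sum.cong refl) (metis assms diff_self mult_zero_left)
  then show ?thesis by (simp add: cov_def)
qed

lemma cov_self_eq_mean:
  assumes "finite S" "S \<noteq> {}"
  shows "cov S f f = mean S (\<lambda>x. (f x - mean S f)\<^sup>2)"
proof -
  have "mean S (\<lambda>x. (f x - mean S f)\<^sup>2) =
    mean S (\<lambda>x. f x * f x - 2 * mean S f * f x + mean S f * mean S f)"
    by (intro mean_cong) (simp add: power2_eq_square algebra_simps)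
  then show ?thesis using assms
    by (simp add: cov_eq mean_add mean_diff mean_cmult mean_const)
qed

lemma cov_self_le:
  assumes "finite S" "S \<noteq> {}"
  shows "cov S f f \<le> mean S (\<lambda>x. (f x - c)\<^sup>2)"
proof -
  have "mean S (\<lambda>x. (f x - c)\<^sup>2) = mean S (\<lambda>x. f x * f x - 2 * c * f x + c * c)"
    by (intro mean_cong) (simp add: power2_eq_square algebra_simps)
  also have "\<dots> = mean S (\<lambda>x. f x * f x) - 2 * c * mean S f + c * c"
    using assms by (simp add: mean_add mean_diff mean_cmult mean_const)
  finally have "mean S (\<lambda>x. (f x - c)\<^sup>2) - cov S f f = (mean S f - c)\<^sup>2"
    using assms by (simp add: cov_eq power2_eq_square algebra_simps)
  then show ?thesis by (smt (verit) zero_le_power2)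
qed

text \<open>On a fibre of \<open>X\<close> the factor \<open>k\<close> is constant, and the
  conditional mean has the same sum there as \<open>f\<close>.\<close>

lemma sum_condmean:
  assumes "finite S" and k: "\<And>x y. x \<in> S \<Longrightarrow> y \<in> S \<Longrightarrow> X x = X y \<Longrightarrow> k x = k y"
  shows "(\<Sum>x\<in>S. condmean S X f x * k x) = (\<Sum>x\<in>S. f x * k x)"
proof -
  have "(\<Sum>x\<in>{x \<in> S. X x = b}. condmean S X f x * k x) = (\<Sum>x\<in>{x \<in> S. X x = b}. f x * k x)"
    if b: "b \<in> X ` S" for b
  proof -
    let ?T = "{x \<in> S. X x = b}"
    obtain a where a: "a \<in> ?T" using b by auto
    have fT: "finite ?T" using assms(1) by simp
    have "(\<Sum>x\<in>?T. condmean S X f x * k x) = (\<Sum>x\<in>?T. mean ?T f * k a)"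
      using a by (intro sum.cong) (auto simp: condmean_def intro: k)
    also have "\<dots> = (\<Sum>x\<in>?T. f x) * k a"
      using a fT by (auto simp: mean_def card_eq_0_iff)
    also have "\<dots> = (\<Sum>x\<in>?T. f x * k x)"
      unfolding sum_distrib_right using a by (intro sum.cong) (auto intro!: arg_cong[where f="(*) _"] k)
    finally show ?thesis .
  qed
  then show ?thesis
    using sum.image_gen[OF assms(1), of "\<lambda>x. condmean S X f x * k x" X]
      sum.image_gen[OF assms(1), of "\<lambda>x. f x * k x" X] by simp
qed

lemma mean_condmean:
  assumes "finite S" and "\<And>x y. x \<in> S \<Longrightarrow> y \<in> S \<Longrightarrow> X x = X y \<Longrightarrow> k x = k y"
  shows "mean S (\<lambda>x. condmean S X f x * k x) = mean S (\<lambda>x. f x * k x)"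
  unfolding mean_def using sum_condmean[OF assms, of X] by simp

lemma condmean_cong: "X x = X y \<Longrightarrow> condmean S X f x = condmean S X f y"
  by (simp add: condmean_def)

lemma cov_condmean:
  assumes "finite S" "S \<noteq> {}" and "\<And>x y. x \<in> S \<Longrightarrow> y \<in> S \<Longrightarrow> X x = X y \<Longrightarrow> k x = k y"
  shows "cov S (condmean S X f) k = cov S f k"
proof -
  have "mean S (\<lambda>x. condmean S X f x * k x) = mean S (\<lambda>x. f x * k x)"
    by (rule mean_condmean[OF assms(1)]) (rule assms(3))
  moreover have "mean S (condmean S X f) = mean S f"
    using mean_condmean[OF assms(1), of X "\<lambda>_. 1" f] by simp
  ultimately show ?thesis using assms(1,2) by (simp add: cov_eq)
qed

lemma total_variance:
  assumes "finite S" "S \<noteq> {}"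
  shows "cov S f f = mean S (\<lambda>x. cov {y \<in> S. X y = X x} f f) + cov S (condmean S X f) (condmean S X f)"
proof -
  let ?\<phi> = "condmean S X f"
  have "mean S (\<lambda>x. cov {y \<in> S. X y = X x} f f) = mean S (condmean S X (\<lambda>x. (f x - ?\<phi> x)\<^sup>2))"
  proof (rule mean_cong)
    fix x assume x: "x \<in> S"
    let ?T = "{y \<in> S. X y = X x}"
    have "cov ?T f f = mean ?T (\<lambda>y. (f y - mean ?T f)\<^sup>2)"
      using assms(1) x by (intro cov_self_eq_mean) auto
    also have "\<dots> = mean ?T (\<lambda>y. (f y - ?\<phi> y)\<^sup>2)"
      by (intro mean_cong) (auto simp: condmean_def)
    finally show "cov ?T f f = condmean S X (\<lambda>x. (f x - ?\<phi> x)\<^sup>2) x" by (simp add: condmean_def)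
  qed
  also have "\<dots> = mean S (\<lambda>x. (f x - ?\<phi> x)\<^sup>2)"
    using mean_condmean[OF assms(1), of X "\<lambda>_. 1"] by simp
  also have "\<dots> = mean S (\<lambda>x. f x * f x - 2 * (f x * ?\<phi> x) + ?\<phi> x * ?\<phi> x)"
    by (intro mean_cong) (simp add: power2_eq_square algebra_simps)
  also have "\<dots> = mean S (\<lambda>x. f x * f x) - 2 * mean S (\<lambda>x. f x * ?\<phi> x) + mean S (\<lambda>x. ?\<phi> x * ?\<phi> x)"
    by (simp add: mean_add mean_diff mean_cmult)
  finally have 1: "mean S (\<lambda>x. cov {y \<in> S. X y = X x} f f) =
    mean S (\<lambda>x. f x * f x) - 2 * mean S (\<lambda>x. f x * ?\<phi> x) + mean S (\<lambda>x. ?\<phi> x * ?\<phi> x)" .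
  have 2: "mean S (\<lambda>x. ?\<phi> x * ?\<phi> x) = mean S (\<lambda>x. f x * ?\<phi> x)"
    by (rule mean_condmean[OF assms(1)]) (rule condmean_cong)
  have 3: "mean S ?\<phi> = mean S f"
    using mean_condmean[OF assms(1), of X "\<lambda>_. 1" f] by simp
  show ?thesis unfolding cov_eq[OF assms] 1 2 3 by simp
qed

subsection \<open>Height functions with given boundary values\<close>

definition fillings :: "(int ^ 'd::finite) set \<Rightarrow> (int ^ 'd \<Rightarrow> int) \<Rightarrow> (int ^ 'd \<Rightarrow> int) set" where
  "fillings U b = {h \<in> heights. \<forall>v. v \<notin> U \<longrightarrow> h v = b v}"

lemma infinite_lattice: "infinite (UNIV :: (int ^ 'd::finite) set)"
proof
  assume "finite (UNIV :: (int ^ 'd) set)"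
  moreover have "inj (\<lambda>n. (\<chi> i. n) :: int ^ 'd)" by (auto simp: inj_def vec_eq_iff)
  ultimately show False by (metis finite_imageD finite_subset infinite_UNIV_int subset_UNIV)
qed

lemma finite_fillings:
  assumes "finite U"
  shows "finite (fillings U b)"
proof -
  obtain p where p: "p \<notin> U" using assms infinite_lattice by (metis UNIV_eq_I)
  let ?B = "\<lambda>x. {b p - l1 x p..b p + l1 x p}"
  have "inj_on (\<lambda>h. restrict h U) (fillings U b)"
  proof (rule inj_onI)
    fix h h' assume *: "h \<in> fillings U b" "h' \<in> fillings U b" "restrict h U = restrict h' U"
    show "h = h'"
    proof
      fix x show "h x = h' x" using *(1,2) fun_cong[OF *(3), of x] by (cases "x \<in> U") (auto simp: fillings_def)
    qed
  qed
  moreover have "(\<lambda>h. restrict h U) ` fillings U b \<subseteq> Pi\<^sub>E U ?B"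
  proof (intro image_subsetI restrict_PiE_iff[THEN iffD2] ballI)
    fix h x assume "h \<in> fillings U b"
    then have "\<bar>h x - b p\<bar> \<le> l1 x p" using heights_lipschitz[of h x p] p by (auto simp: fillings_def)
    then show "h x \<in> ?B x" by auto
  qed
  moreover have "finite (Pi\<^sub>E U ?B)" using assms by (intro finite_PiE) auto
  ultimately show ?thesis by (rule inj_on_finite)
qed

lemma mem_fillings: "b \<in> heights \<Longrightarrow> b \<in> fillings U b"
  by (simp add: fillings_def)

lemma fillings_heights: "h \<in> fillings U b \<Longrightarrow> h \<in> heights"
  by (simp add: fillings_def)

text \<open>Spatial Markov property: conditioning on the height at \<open>u\<close> removes
  \<open>u\<close> from the domain, so conditional means are again mean heights, for a smaller
  domain.\<close>

lemma fillings_pin: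
  assumes "h \<in> fillings U b"
  shows "{h' \<in> fillings U b. h' u = h u} = fillings (U - {u}) h"
  using assms by (auto simp: fillings_def)

section \<open>Swapping two height functions on a disagreement cluster\<close>

definition cluster :: "int ^ 'd::finite \<Rightarrow> (int ^ 'd \<Rightarrow> int) \<Rightarrow> (int ^ 'd \<Rightarrow> int) \<Rightarrow> (int ^ 'd) set" where
  "cluster v h h' = {(x, y). adjacent x y \<and> h x \<noteq> h' x \<and> h y \<noteq> h' y}\<^sup>* `` {v}"

definition swap :: "int ^ 'd::finite \<Rightarrow> (int ^ 'd \<Rightarrow> int) \<times> (int ^ 'd \<Rightarrow> int) \<Rightarrow>
    (int ^ 'd \<Rightarrow> int) \<times> (int ^ 'd \<Rightarrow> int)" where
  "swap v = (\<lambda>(h, h'). ((\<lambda>x. if x \<in> cluster v h h' then h' x else h x),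
     (\<lambda>x. if x \<in> cluster v h h' then h x else h' x)))"

lemma self_mem_cluster: "v \<in> cluster v h h'"
  by (simp add: cluster_def)

text \<open>The set where the two functions differ is symmetric in them, so the swapped pair has the
  same cluster.\<close>

lemma swap_swap: "swap v (swap v p) = p"
proof -
  obtain h h' where p: "p = (h, h')" by (cases p)
  let ?C = "cluster v h h'"
  let ?g = "\<lambda>x. if x \<in> ?C then h' x else h x" and ?g' = "\<lambda>x. if x \<in> ?C then h x else h' x"
  have "?g x \<noteq> ?g' x \<longleftrightarrow> h x \<noteq> h' x" for x by auto
  then have "cluster v ?g ?g' = ?C" by (simp add: cluster_def)
  moreover have "swap v p = (?g, ?g')" by (simp add: swap_def p)
  ultimately show ?thesis by (auto simp: swap_def p fun_eq_iff)
qed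

text \<open>The difference \<open>h - h'\<close> is even and changes by at most 2 along an edge, so
  it cannot turn negative without vanishing, and it never vanishes on the cluster.\<close>

lemma cluster_less:
  assumes "h \<in> heights" "h' \<in> heights" "h' v < h v" "x \<in> cluster v h h'"
  shows "h' x < h x"
proof -
  have "(v, x) \<in> {(x, y). adjacent x y \<and> h x \<noteq> h' x \<and> h y \<noteq> h' y}\<^sup>*"
    using assms(4) by (simp add: cluster_def)
  then show ?thesis
  proof (induction rule: rtrancl_induct)
    case (step y z)
    then have "\<bar>h y - h z\<bar> = 1" "\<bar>h' y - h' z\<bar> = 1" "h z \<noteq> h' z"
      using heights_adjacent assms(1,2) by auto
    moreover have "even (h y - h' y)" using heights_even_diff assms(1,2) by blast
    ultimately show ?case using step.IH by presburger
  qed (rule assms(3))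
qed

lemma cluster_boundary:
  assumes "h v \<noteq> h' v" "x \<in> cluster v h h'" "y \<notin> cluster v h h'" "adjacent x y"
  shows "h y = h' y"
proof (rule ccontr)
  assume ne: "h y \<noteq> h' y"
  let ?R = "{(x, y). adjacent x y \<and> h x \<noteq> h' x \<and> h y \<noteq> h' y}"
  have vx: "(v, x) \<in> ?R\<^sup>*" using assms(2) by (simp add: cluster_def)
  then have "h x \<noteq> h' x" by (induction rule: rtrancl_induct) (use assms(1) in auto)
  then have "(x, y) \<in> ?R" using assms(4) ne by simp
  with vx have "(v, y) \<in> ?R\<^sup>*" by (rule rtrancl_into_rtrancl)
  then show False using assms(3) by (simp add: cluster_def)
qed

text \<open>Outside neighbours of \<open>C\<close> see no difference between \<open>h\<close> and
  \<open>h'\<close>, so an edge leaving \<open>C\<close> carries an increment of \<open>h'\<close>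
  alone.\<close>

lemma glue_heights:
  assumes "h \<in> heights" "h' \<in> heights"
    and "\<And>x y. x \<in> C \<Longrightarrow> y \<notin> C \<Longrightarrow> adjacent x y \<Longrightarrow> h y = h' y"
  shows "(\<lambda>x. if x \<in> C then h' x else h x) \<in> heights"
  unfolding heights_def
proof (intro CollectI conjI allI impI)
  fix u v :: "int ^ 'a" assume uv: "adjacent u v"
  show "\<bar>(if u \<in> C then h' u else h u) - (if v \<in> C then h' v else h v)\<bar> \<le> 1"
    using heights_adjacent[OF assms(1) uv] heights_adjacent[OF assms(2) uv]
      assms(3)[of u v] assms(3)[of v u] uv adjacent_commute[of u v] by auto
next
  fix v show "even ((if v \<in> C then h' v else h v) - csum v)"
    using assms(1,2) heights_parity by auto
qed

lemma swap_fillings: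
  assumes b: "b \<in> heights" "b' \<in> heights" and le: "\<And>x. x \<notin> U \<Longrightarrow> b x \<le> b' x"
    and h: "h \<in> fillings U b" "h' \<in> fillings U b'" and lt: "h' v < h v"
  shows "swap v (h, h') \<in> fillings U b \<times> fillings U b'"
proof -
  let ?C = "cluster v h h'"
  have hh: "h \<in> heights" "h' \<in> heights" using h fillings_heights by auto
  have C: "?C \<subseteq> U"
  proof
    fix x assume "x \<in> ?C"
    then have "h' x < h x" by (rule cluster_less[OF hh lt])
    then show "x \<in> U" using h le[of x] by (fastforce simp: fillings_def)
  qed
  have bd: "h y = h' y" if "x \<in> ?C" "y \<notin> ?C" "adjacent x y" for x y
    using cluster_boundary[of h v h' x y] lt that by auto
  have "(\<lambda>x. if x \<in> ?C then h' x else h x) \<in> heights"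
    using glue_heights[OF hh, of ?C] bd by blast
  moreover have "(\<lambda>x. if x \<in> ?C then h x else h' x) \<in> heights"
    using glue_heights[OF hh(2,1), of ?C] bd by metis
  ultimately show ?thesis using C h by (auto simp: swap_def fillings_def)
qed

definition height_mean :: "(int ^ 'd::finite) set \<Rightarrow> (int ^ 'd \<Rightarrow> int) \<Rightarrow> int ^ 'd \<Rightarrow> real" where
  "height_mean U b v = mean (fillings U b) (\<lambda>h. real_of_int (h v))"

text \<open>Swapping \<open>h\<close> and \<open>h'\<close> on the cluster of \<open>v\<close> changes the sign of \<open>h' v - h v\<close>. If \<open>h' v < h v\<close>, then
  the cluster lies inside \<open>U\<close>, so that swapping injects the pairs with a negative difference into
  those with a positive one.\<close>

lemma height_mean_mono:
  assumes U: "finite U" and b: "b \<in> heights" "b' \<in> heights" and le: "\<And>x. x \<notin> U \<Longrightarrow> b x \<le> b' x"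
  shows "height_mean U b v \<le> height_mean U b' v"
proof -
  let ?H = "fillings U b" and ?H' = "fillings U b'"
  let ?P = "?H \<times> ?H'"
  let ?D = "\<lambda>p. snd p v - fst p v :: int"
  let ?neg = "{p \<in> ?P. ?D p < 0}" and ?pos = "{p \<in> ?P. 0 < ?D p}"
  have fin: "finite ?H" "finite ?H'" using U finite_fillings by auto
  have ne: "?H \<noteq> {}" "?H' \<noteq> {}" using b mem_fillings by auto
  have fP: "finite ?P" using fin by simp
  have D: "?D (swap v p) = - ?D p" for p by (cases p) (simp add: swap_def self_mem_cluster)
  have sub: "swap v ` ?neg \<subseteq> ?pos"
  proof
    fix q assume "q \<in> swap v ` ?neg"
    then obtain h h' where q: "q = swap v (h, h')" "h \<in> ?H" "h' \<in> ?H'" "h' v < h v" by auto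
    have "q \<in> ?P" unfolding q(1) by (rule swap_fillings[OF b le q(2-4)])
    moreover have "0 < ?D q" unfolding q(1) D using q(4) by simp
    ultimately show "q \<in> ?pos" by simp
  qed
  have inj: "inj_on (swap v) ?neg" by (rule inj_on_inverseI) (rule swap_swap)
  have "(\<Sum>p\<in>?neg. ?D p) = - (\<Sum>q\<in>swap v ` ?neg. ?D q)"
    unfolding sum.reindex[OF inj] comp_def D sum_negf by simp
  moreover have "(\<Sum>q\<in>swap v ` ?neg. ?D q) \<le> (\<Sum>q\<in>?pos. ?D q)"
    using sub fP by (intro sum_mono2) auto
  moreover have "(\<Sum>p\<in>?P. ?D p) = (\<Sum>p\<in>?neg. ?D p) + (\<Sum>p\<in>?pos. ?D p)"
  proof -
    have "(\<Sum>p\<in>?P. ?D p) = (\<Sum>p\<in>?neg \<union> ?pos. ?D p)"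
      using fP by (intro sum.mono_neutral_right) auto
    also have "\<dots> = (\<Sum>p\<in>?neg. ?D p) + (\<Sum>p\<in>?pos. ?D p)"
      using fP by (intro sum.union_disjoint) auto
    finally show ?thesis .
  qed
  ultimately have "0 \<le> (\<Sum>p\<in>?P. ?D p)" by linarith
  also have "\<dots> = (\<Sum>h\<in>?H. \<Sum>h'\<in>?H'. h' v - h v)"
    by (simp add: sum.cartesian_product case_prod_unfold)
  also have "\<dots> = int (card ?H) * (\<Sum>h'\<in>?H'. h' v) - int (card ?H') * (\<Sum>h\<in>?H. h v)"
    by (simp add: sum_subtractf sum_distrib_left)
  finally have "real_of_int (int (card ?H') * (\<Sum>h\<in>?H. h v)) \<le> real_of_int (int (card ?H) * (\<Sum>h'\<in>?H'. h' v))"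
    by linarith
  moreover have "0 < real (card ?H)" "0 < real (card ?H')" using fin ne by (auto simp: card_gt_0_iff)
  ultimately show ?thesis
    by (simp add: height_mean_def mean_def divide_le_eq le_divide_eq field_simps)
qed

lemma heights_shift:
  assumes "h \<in> heights" "even t"
  shows "(\<lambda>x. h x + t) \<in> heights"
proof -
  have "even (h v + t - csum v)" for v using heights_parity[OF assms(1), of v] assms(2) by presburger
  then show ?thesis using assms(1) by (simp add: heights_def)
qed

lemma height_mean_shift:
  assumes "even t" and that: "finite U" "b \<in> heights"
  shows "height_mean U (\<lambda>x. b x + t) v = height_mean U b v + real_of_int t"
proof -
  have "bij_betw (\<lambda>h x. h x + t) (fillings U b) (fillings U (\<lambda>x. b x + t))"
    using heights_shift[OF _ assms(1)] heights_shift[of _ "- t"] assms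
    by (intro bij_betw_byWitness[where f' = "\<lambda>h x. h x - t"]) (auto simp: fillings_def)
  then have "height_mean U (\<lambda>x. b x + t) v = mean (fillings U b) (\<lambda>h. real_of_int (h v + t))"
    unfolding height_mean_def by (rule mean_reindex)
  moreover have "finite (fillings U b)" "fillings U b \<noteq> {}"
    using finite_fillings[OF that(1), of b] mem_fillings[OF that(2), of U] by auto
  ultimately show ?thesis by (simp add: height_mean_def mean_add mean_const)
qed

subsection \<open>Variance bounds\<close>

abbreviation (input) height_at :: "int ^ 'd::finite \<Rightarrow> (int ^ 'd \<Rightarrow> int) \<Rightarrow> real" where
  "height_at v h \<equiv> real_of_int (h v)"

lemma condmean_fillings:
  assumes "h \<in> fillings U b"
  shows "condmean (fillings U b) (\<lambda>h. h u) (height_at v) h = height_mean (U - {u}) h v"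
  using fillings_pin[OF assms, of u] by (simp add: condmean_def height_mean_def)

text \<open>Both bounds are instances of monotonicity in the boundary values: off
  \<open>U - {u}\<close> the function \<open>h2\<close> dominates \<open>h1\<close> and is dominated
  by \<open>h1\<close> raised by \<open>h2 u - h1 u\<close>, with equality at
  \<open>u\<close>.\<close>

lemma height_mean_pin_mono:
  assumes U: "finite U" and h: "h1 \<in> fillings U b" "h2 \<in> fillings U b" and le: "h1 u \<le> h2 u"
  shows "height_mean (U - {u}) h1 v \<le> height_mean (U - {u}) h2 v"
    and "height_mean (U - {u}) h2 v \<le> height_mean (U - {u}) h1 v + real_of_int (h2 u - h1 u)"
proof -
  let ?t = "h2 u - h1 u"
  have hh: "h1 \<in> heights" "h2 \<in> heights" using h fillings_heights by auto
  have fin: "finite (U - {u})" using U by simp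
  have ev: "even ?t" using heights_even_diff[OF hh(2,1), of u] .
  have eq: "h1 x = h2 x" if "x \<notin> U" for x using h that by (simp add: fillings_def)
  show "height_mean (U - {u}) h1 v \<le> height_mean (U - {u}) h2 v"
    by (rule height_mean_mono[OF fin hh]) (use eq le in force)
  have "height_mean (U - {u}) h2 v \<le> height_mean (U - {u}) (\<lambda>x. h1 x + ?t) v"
    by (rule height_mean_mono[OF fin hh(2) heights_shift[OF hh(1) ev]]) (use eq le in force)
  then show "height_mean (U - {u}) h2 v \<le> height_mean (U - {u}) h1 v + real_of_int ?t"
    by (simp only: height_mean_shift[OF ev fin hh(1)])
qed

context
  fixes U :: "(int ^ 'd::finite) set" and b :: "int ^ 'd \<Rightarrow> int"
  assumes finU: "finite U" and b: "b \<in> heights"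
begin

lemma fillings_nonempty: "finite (fillings U b)" "fillings U b \<noteq> {}"
  using finite_fillings[OF finU] mem_fillings[OF b] by auto

text \<open>Given \<open>h u\<close>, the height at \<open>v\<close> is \<open>h u\<close> plus or
  minus 1, so the conditional variance is at most 1; the conditional mean is a 1-Lipschitz function
  of \<open>h u\<close> and so has no larger variance. The law of total variance adds the
  two.\<close>

lemma variance_adjacent:
  assumes "adjacent v u"
  shows "cov (fillings U b) (height_at v) (height_at v) \<le> cov (fillings U b) (height_at u) (height_at u) + 1"
proof -
  let ?F = "fillings U b"
  let ?\<phi> = "condmean ?F (\<lambda>h. h u) (height_at v)"
  have "cov {h' \<in> ?F. h' u = h u} (height_at v) (height_at v) \<le> 1" if "h \<in> ?F" for h
  proof -
    have fin: "finite {h' \<in> ?F. h' u = h u}" "{h' \<in> ?F. h' u = h u} \<noteq> {}"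
      using fillings_nonempty that by auto
    have "(height_at v h' - height_at u h)\<^sup>2 = 1" if "h' \<in> {h' \<in> ?F. h' u = h u}" for h'
    proof -
      have "\<bar>h' v - h u\<bar> = 1" using heights_adjacent[OF _ assms, of h'] that fillings_heights by fastforce
      then have "(real_of_int (h' v - h u))\<^sup>2 = 1" by (metis of_int_1 of_int_power power2_abs power_one)
      then show ?thesis by simp
    qed
    then have "mean {h' \<in> ?F. h' u = h u} (\<lambda>h'. (height_at v h' - height_at u h)\<^sup>2) = 1"
      using mean_const[OF fin, of 1] mean_cong[of _ _ "\<lambda>_. 1"] by (metis (mono_tags, lifting))
    then show ?thesis using cov_self_le[OF fin, of "height_at v" "height_at u h"] by simp
  qed
  then have "mean ?F (\<lambda>h. cov {h' \<in> ?F. h' u = h u} (height_at v) (height_at v)) \<le> mean ?F (\<lambda>_. 1)"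
    by (intro mean_mono) auto
  then have 1: "mean ?F (\<lambda>h. cov {h' \<in> ?F. h' u = h u} (height_at v) (height_at v)) \<le> 1"
    using fillings_nonempty by (simp add: mean_const)
  have lip: "\<bar>?\<phi> x - ?\<phi> y\<bar> \<le> \<bar>height_at u x - height_at u y\<bar>" if xy: "x \<in> ?F" "y \<in> ?F" for x y
  proof (cases "x u \<le> y u")
    case True
    show ?thesis using height_mean_pin_mono[OF finU xy True, of v] True
      by (simp add: condmean_fillings xy)
  next
    case False
    then have "y u \<le> x u" by simp
    from height_mean_pin_mono[OF finU xy(2,1) this, of v] show ?thesis using False
      by (simp add: condmean_fillings xy)
  qed
  have 2: "cov ?F ?\<phi> ?\<phi> \<le> cov ?F (height_at u) (height_at u)"
    by (rule cov_mono) (use lip in \<open>simp add: abs_le_square_iff power2_eq_square[symmetric]\<close>)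
  show ?thesis using 1 2 total_variance[OF fillings_nonempty, of "height_at v" "\<lambda>h. h u"] by simp
qed

lemma variance_path:
  "cov (fillings U b) (height_at v) (height_at v) \<le>
    cov (fillings U b) (height_at u) (height_at u) + real_of_int (l1 v u)"
proof (induction rule: l1_induct)
  case (2 x z y)
  then show ?case using variance_adjacent[OF 2(1)] by simp
qed simp

lemma variance_pinned:
  assumes "u \<notin> U"
  shows "cov (fillings U b) (height_at v) (height_at v) \<le> real_of_int (l1 v u)"
proof -
  have "cov (fillings U b) (height_at u) (height_at u) = 0"
    by (rule cov_eq_0) (use assms in \<open>simp add: fillings_def\<close>)
  then show ?thesis using variance_path[of v u] by simp
qed

end

text \<open>Let \<open>a\<close>, \<open>b\<close> be the heights at \<open>u\<close>, \<open>v\<close> and \<open>\<phi>\<close> the conditional mean of \<open>b\<close> given \<open>a\<close>. By monotonicity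
  both \<open>\<phi>\<close> and \<open>a - \<phi>\<close> increase with \<open>a\<close>, so they are positively correlated and
  \<open>Cov(a, b) = Cov(a, \<phi>) \<ge> Var \<phi>\<close>, which by the law of total variance is \<open>Var b\<close> up to the distance.\<close>

lemma variance_diff:
  assumes finU: "finite U" and b: "b \<in> heights"
  shows "cov (fillings U b) (\<lambda>h. height_at v h - height_at u h) (\<lambda>h. height_at v h - height_at u h)
    \<le> 3 * real_of_int (l1 v u)"
proof -
  define X where "X h = height_at v h - height_at u h" for h
  let ?F = "fillings U b" and ?k = "real_of_int (l1 v u)"
  let ?A = "height_at u" and ?B = "height_at v"
  let ?\<phi> = "condmean ?F (\<lambda>h. h u) ?B"
  note F = fillings_nonempty[OF finU b]
  have "cov {h' \<in> ?F. h' u = h u} ?B ?B \<le> ?k" if "h \<in> ?F" for h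
    using variance_pinned[of "U - {u}" h u v] finU fillings_heights[OF that] fillings_pin[OF that, of u]
    by simp
  then have "mean ?F (\<lambda>h. cov {h' \<in> ?F. h' u = h u} ?B ?B) \<le> mean ?F (\<lambda>_. ?k)"
    by (intro mean_mono) auto
  then have 1: "cov ?F ?B ?B - ?k \<le> cov ?F ?\<phi> ?\<phi>"
    using F total_variance[OF F, of ?B "\<lambda>h. h u"] by (simp add: mean_const)
  have "0 \<le> (?\<phi> x - ?\<phi> y) * ((?A x - ?\<phi> x) - (?A y - ?\<phi> y))" if xy: "x \<in> ?F" "y \<in> ?F" for x y
  proof (cases "x u \<le> y u")
    case True
    show ?thesis using height_mean_pin_mono[OF finU xy True, of v]
      by (intro mult_nonpos_nonpos) (simp_all add: condmean_fillings xy)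
  next
    case False
    then have "y u \<le> x u" by simp
    from height_mean_pin_mono[OF finU xy(2,1) this, of v] show ?thesis
      by (intro mult_nonneg_nonneg) (simp_all add: condmean_fillings xy)
  qed
  then have "0 \<le> cov ?F ?\<phi> (\<lambda>h. ?A h - ?\<phi> h)" by (rule cov_nonneg)
  then have 2: "cov ?F ?\<phi> ?\<phi> \<le> cov ?F ?\<phi> ?A" by (simp add: cov_diff_right)
  have 3: "cov ?F ?\<phi> ?A = cov ?F ?B ?A" by (rule cov_condmean[OF F]) simp
  have "cov ?F X X = cov ?F X ?B - cov ?F X ?A" unfolding X_def by (rule cov_diff_right)
  also have "\<dots> = cov ?F ?B ?B - cov ?F ?B ?A - (cov ?F ?A ?B - cov ?F ?A ?A)"
    unfolding X_def by (simp only: cov_commute[of _ "\<lambda>h. ?B h - ?A h"] cov_diff_right)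
  finally have "cov ?F X X = cov ?F ?B ?B - 2 * cov ?F ?B ?A + cov ?F ?A ?A"
    by (simp add: cov_commute[of _ ?A ?B])
  \<comment> \<open>As Cov(a, b) is at least Var b - k and Var a is at most Var b + k, the sum Var b
    - 2 Cov(a, b) + Var a is at most 3k.\<close>
  then have "cov ?F X X \<le> 3 * ?k"
    using 1 2 3 variance_path[OF finU b, of u v] by (simp add: l1_commute)
  then show ?thesis by (simp add: X_def[abs_def])
qed

lemma heights_reflect:
  assumes "h \<in> heights" "even t"
  shows "(\<lambda>x. t - h x) \<in> heights"
proof -
  have "even (t - h v - csum v)" for v using heights_parity[OF assms(1), of v] assms(2) by presburger
  then show ?thesis using assms(1) by (auto simp: heights_def abs_minus_commute)
qed

text \<open>The reflected boundary values \<open>6 - b\<close> lie within 2 of \<open>b\<close>, so the mean lies within 2 of its own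
  reflection.\<close>

lemma height_mean_bounds:
  assumes U: "finite U" and b: "b \<in> heights" and bd: "\<And>x. x \<notin> U \<Longrightarrow> b x \<in> {2..4}"
  shows "height_mean U b v \<in> {2..4}"
proof -
  let ?b = "\<lambda>x. 6 - b x"
  have ref: "?b \<in> heights" using heights_reflect[OF b, of 6] by simp
  have "bij_betw (\<lambda>h x. 6 - h x) (fillings U b) (fillings U ?b)"
    using heights_reflect[of _ 6]
    by (intro bij_betw_byWitness[where f' = "\<lambda>h x. 6 - h x"]) (auto simp: fillings_def)
  then have "height_mean U ?b v = mean (fillings U b) (\<lambda>h. real_of_int (6 - h v))"
    unfolding height_mean_def by (rule mean_reindex)
  then have eq: "height_mean U ?b v = 6 - height_mean U b v"
    using fillings_nonempty[OF U b] by (simp add: height_mean_def mean_diff mean_const)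
  have ev: "even (2 :: int)" by simp
  have "height_mean U b v \<le> height_mean U (\<lambda>x. ?b x + 2) v"
    by (rule height_mean_mono[OF U b heights_shift[OF ref ev]]) (use bd in force)
  moreover have "height_mean U ?b v \<le> height_mean U (\<lambda>x. b x + 2) v"
    by (rule height_mean_mono[OF U ref heights_shift[OF b ev]]) (use bd in force)
  ultimately show ?thesis
    using height_mean_shift[OF ev U ref, of v] height_mean_shift[OF ev U b, of v] eq by simp
qed

text \<open>The variance contributes 3 per unit of distance; both means lie in
  \<open>{2..4}\<close>, so the squared mean contributes at most 4.\<close>

lemma second_moment:
  assumes U: "finite U" and b: "b \<in> heights" and bd: "\<And>x. x \<notin> U \<Longrightarrow> b x \<in> {2..4}"
  shows "mean (fillings U b) (\<lambda>h. (real_of_int (h v - h u))\<^sup>2) \<le> 3 * real_of_int (l1 v u) + 4"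
proof -
  let ?F = "fillings U b" and ?X = "\<lambda>h. height_at v h - height_at u h"
  have mv: "height_mean U b v \<in> {2..4}" and mu: "height_mean U b u \<in> {2..4}"
    by (rule height_mean_bounds[OF U b bd], assumption)+
  have "mean ?F ?X = height_mean U b v - height_mean U b u"
    by (simp add: height_mean_def mean_diff)
  then have "\<bar>mean ?F ?X\<bar> \<le> 2"
    using mv mu by auto
  then have "(mean ?F ?X)\<^sup>2 \<le> 2\<^sup>2" using abs_le_square_iff[of "mean ?F ?X" 2] by simp
  then show ?thesis
    using variance_diff[OF U b, of v u] cov_eq[OF fillings_nonempty[OF U b], of ?X ?X]
    by (simp add: power2_eq_square)
qed

subsection \<open>Lifting colorings to height functions\<close>

lemma mem_C3_iff:
  "c \<in> C3 \<longleftrightarrow> (\<forall>v. c v \<in> {0, 1, 2}) \<and> (\<forall>u v. adjacent u v \<longrightarrow> c u \<noteq> c v)"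
  by (simp add: C3_def proper_colorings_def PiE_UNIV_domain Pi_iff)

definition color :: "(int ^ 'd::finite \<Rightarrow> int) \<Rightarrow> int ^ 'd \<Rightarrow> nat" where
  "color h v = nat (h v mod 3)"

lemma color_eq_iff: "color h v = color h' w \<longleftrightarrow> h v mod 3 = h' w mod 3"
  unfolding color_def by (subst nat_eq_iff2) auto

lemma color_mem_C3:
  assumes "h \<in> heights"
  shows "color h \<in> C3"
  unfolding mem_C3_iff
proof (intro conjI allI impI)
  fix v :: "int ^ 'a"
  have "h v mod 3 = 0 \<or> h v mod 3 = 1 \<or> h v mod 3 = 2" by presburger
  then show "color h v \<in> {0, 1, 2}" by (auto simp: color_def)
next
  fix u v :: "int ^ 'a" assume "adjacent u v"
  then have "\<bar>h u - h v\<bar> = 1" using heights_adjacent assms by blast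
  then show "color h u \<noteq> color h v" unfolding color_eq_iff by presburger
qed

section \<open>Potentials of closed forms and the lift of a coloring\<close>

lemma int_const:
  fixes f :: "int \<Rightarrow> 'a"
  assumes "\<And>k. f (k + 1) = f k"
  shows "f k = f l"
proof -
  have "f k = f 0" for k
  proof (induction k rule: int_induct[where k = 0])
    case (step2 i)
    then show ?case using assms[of "i - 1"] by simp
  qed (use assms in auto)
  then show ?thesis by metis
qed

lemma int_antidifference:
  fixes q :: "int \<Rightarrow> int"
  obtains Q where "Q 0 = 0" "\<And>k. Q (k + 1) - Q k = q k"
proof -
  define Q where "Q k = (\<Sum>t\<in>{0..<k}. q t) - (\<Sum>t\<in>{k..<0}. q t)" for k
  have "Q (k + 1) - Q k = q k" for k
  proof (cases "0 \<le> k")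
    case True
    then have "{0..<k + 1} = insert k {0..<k}" by auto
    then show ?thesis using True by (simp add: Q_def)
  next
    case False
    then have "{k..<0} = insert k {k + 1..<0}" by auto
    then show ?thesis using False by (simp add: Q_def)
  qed
  moreover have "Q 0 = 0" by (simp add: Q_def)
  ultimately show ?thesis using that by blast
qed

abbreviation succ_coord :: "'d::finite \<Rightarrow> int ^ 'd \<Rightarrow> int ^ 'd" where
  "succ_coord i x \<equiv> upd x i (x $ i + 1)"

lemma upd_commute: "i \<noteq> j \<Longrightarrow> upd (upd x i a) j b = upd (upd x j b) i a"
  by (simp add: vec_eq_iff)

text \<open>Directions are integrated one at a time: a potential for the old ones is kept on the
  slice where coordinate \<open>j\<close> vanishes and summed up from there along direction
  \<open>j\<close>. This is the discrete Poincare lemma.\<close>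

lemma closed_form_exact:
  fixes g :: "'d::finite \<Rightarrow> int ^ 'd \<Rightarrow> int"
  assumes closed: "\<And>i j x. i \<noteq> j \<Longrightarrow> g i x + g j (succ_coord i x) = g j x + g i (succ_coord j x)"
  obtains h where "\<And>i x. h (succ_coord i x) - h x = g i x"
proof -
  have "\<exists>h. \<forall>i\<in>S. \<forall>x. h (succ_coord i x) - h x = g i x" if "finite S" for S
    using that
  proof (induction S)
    case (insert j S)
    then obtain h where h: "\<And>i x. i \<in> S \<Longrightarrow> h (succ_coord i x) - h x = g i x" by blast
    have "\<forall>q :: int \<Rightarrow> int. \<exists>Q. Q 0 = 0 \<and> (\<forall>k. Q (k + 1) - Q k = q k)"
      using int_antidifference by metis
    from choice[OF this] obtain Q :: "(int \<Rightarrow> int) \<Rightarrow> int \<Rightarrow> int" where Q: "\<And>q. Q q 0 = (0 :: int)" "\<And>q k. Q q (k + 1) - Q q k = q k"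
      by blast
    define h' where "h' x = h (upd x j 0) + Q (\<lambda>t. g j (upd x j t)) (x $ j)" for x
    have j: "h' (succ_coord j x) - h' x = g j x" for x
      using Q(2)[of "\<lambda>t. g j (upd x j t)" "x $ j"] by (simp add: h'_def)
    have i: "h' (succ_coord i x) - h' x = g i x" if "i \<in> S" for i x
    proof -
      have ij: "i \<noteq> j" using that insert.hyps by auto
      \<comment> \<open>The error in an old direction along a line in direction \<open>j\<close>:
        closedness makes it constant, and it vanishes on the slice \<open>k = 0\<close>.\<close>
      define E where "E k = h' (upd (succ_coord i x) j k) - h' (upd x j k) - g i (upd x j k)" for k
      have "E (k + 1) = E k" for k
        using j[of "upd (succ_coord i x) j k"] j[of "upd x j k"] closed[OF ij, of "upd x j k"] ij
        by (simp add: E_def upd_commute)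
      then have "E (x $ j) = E 0" by (rule int_const)
      also have "\<dots> = 0"
        using h[OF that, of "upd x j 0"] ij Q(1) by (simp add: E_def h'_def upd_commute)
      finally show ?thesis using ij upd_same[of "succ_coord i x" j] by (simp add: E_def)
    qed
    show ?case using i j by (intro exI[of _ h']) auto
  qed simp
  from this[of UNIV] show ?thesis using that by auto
qed

text \<open>Neighbouring colors differ, so each edge has exactly one increment 1 or -1 in the right
  residue class modulo 3. These increments are closed, and their potential is the lift.\<close>

lemma coloring_lift:
  fixes c :: "int ^ 'd::finite \<Rightarrow> nat"
  assumes c: "c \<in> C3"
  obtains h where "h \<in> heights" "color h = c" "h 0 = 4 * int (c 0)"
proof -
  define \<delta> :: "nat \<Rightarrow> nat \<Rightarrow> int" where "\<delta> a b = (if (int b - int a) mod 3 = 1 then 1 else - 1)" for a b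
  define g where "g i x = \<delta> (c x) (c (succ_coord i x))" for i x
  have col: "c x \<in> {0, 1, 2}" for x using c by (simp add: mem_C3_iff)
  have \<delta>: "\<bar>\<delta> (c x) (c y)\<bar> = 1" "\<delta> (c x) (c y) mod 3 = (int (c y) - int (c x)) mod 3"
    if "adjacent x y" for x y
  proof -
    have "c x \<noteq> c y" using c that by (simp add: mem_C3_iff)
    then show "\<bar>\<delta> (c x) (c y)\<bar> = 1" "\<delta> (c x) (c y) mod 3 = (int (c y) - int (c x)) mod 3"
      using col[of x] col[of y] by (auto simp: \<delta>_def)
  qed
  have adj: "adjacent x (succ_coord i x)" for i x by (rule adjacent_upd) simp
  have closed: "g i x + g j (succ_coord i x) = g j x + g i (succ_coord j x)" if "i \<noteq> j" for i j x
  proof -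
    define y z w where "y = succ_coord i x" and "z = succ_coord j x" and "w = succ_coord j y"
    have w: "w = succ_coord i z" using that by (simp add: y_def z_def w_def upd_commute)
    have "adjacent x y" "adjacent x z" "adjacent y w" "adjacent z w"
      using adj[of x i] adj[of x j] adj[of y j] adj[of z i] w
      unfolding y_def[symmetric] z_def[symmetric] w_def[symmetric] by simp_all
    note d = \<delta>[OF this(1)] \<delta>[OF this(2)] \<delta>[OF this(3)] \<delta>[OF this(4)]
    \<comment> \<open>Both two-step sums lie in {-2, 0, 2}, whose elements are distinct modulo 3, so
      congruence becomes equality.\<close>
    have "(\<delta> (c x) (c y) + \<delta> (c y) (c w)) mod 3 = (\<delta> (c x) (c z) + \<delta> (c z) (c w)) mod 3"
      using mod_add_cong[OF d(2) d(6)] mod_add_cong[OF d(4) d(8)] by simp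
    moreover have "\<bar>a\<bar> = 1 \<longleftrightarrow> a = 1 \<or> a = - 1" for a :: int by linarith
    ultimately have "\<delta> (c x) (c y) + \<delta> (c y) (c w) = \<delta> (c x) (c z) + \<delta> (c z) (c w)"
      using d(1,3,5,7) by auto
    then show ?thesis unfolding g_def y_def[symmetric] z_def[symmetric] w_def[symmetric] w[symmetric] .
  qed
  obtain h0 where h0: "\<And>i x. h0 (succ_coord i x) - h0 x = g i x"
    using closed_form_exact[of g] closed by blast
  \<comment> \<open>The factor 4 makes the height at the origin even, as parity demands, and
    congruent to \<open>c 0\<close> modulo 3. The possible values 0, 4, 8 are the source of the
    range \<open>{0..8}\<close> below.\<close>
  define h where "h x = h0 x - h0 0 + 4 * int (c 0)" for x
  have step: "\<bar>h y - h x\<bar> = 1 \<and> (h y - h x) mod 3 = (int (c y) - int (c x)) mod 3" if "adjacent x y" for x y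
  proof -
    obtain i where i: "y = upd x i (y $ i)" "\<bar>y $ i - x $ i\<bar> = 1"
      using \<open>adjacent x y\<close> by (rule adjacentE)
    show ?thesis
    proof (cases "y $ i = x $ i + 1")
      case True
      from i(1) have "y = succ_coord i x" unfolding True .
      then have "h y - h x = \<delta> (c x) (c y)" using h0[of x i] unfolding g_def h_def by simp
      then show ?thesis using \<delta>[OF that] by simp
    next
      case False
      have "y $ j = x $ j" if "j \<noteq> i" for j using that by (subst i(1)) simp
      then have "x = succ_coord i y" using i(2) False by (simp add: vec_eq_iff)
      then have "h x - h y = \<delta> (c y) (c x)" using h0[of y i] unfolding g_def h_def by simp
      moreover have "\<bar>\<delta> (c y) (c x)\<bar> = 1" "\<delta> (c y) (c x) mod 3 = (int (c x) - int (c y)) mod 3"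
        using \<delta>[of y x] that by (simp_all add: adjacent_commute[of y x])
      ultimately have "\<bar>h x - h y\<bar> = 1" "(- (h x - h y)) mod 3 = (- (int (c x) - int (c y))) mod 3"
        by (simp, metis mod_minus_eq)
      then show ?thesis by (simp add: abs_minus_commute)
    qed
  qed
  have "h x mod 3 = int (c x) \<and> even (h x - csum x)" if "y = 0" for x y :: "int ^ 'd"
    using that
  proof (induction x y rule: l1_induct)
    case (1 x)
    then show ?case using col[of 0] by (auto simp: h_def csum_def)
  next
    case (2 x z y)
    have "odd (csum x - csum z)" using l1_parity[of x z] 2(1) by (simp add: adjacent_iff_l1)
    moreover have "\<bar>h z - h x\<bar> = 1" "(h z - h x) mod 3 = (int (c z) - int (c x)) mod 3"
      using step[OF 2(1)] by auto
    moreover have z: "h z mod 3 = int (c z)" "even (h z - csum z)" using 2(3)[OF 2(4)] by auto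
    moreover have "h x mod 3 = int (c x)"
    proof -
      have "h z mod 3 = int (c z) mod 3" using z(1) col[of z] by auto
      from mod_diff_cong[OF this, of "h z - h x" "int (c z) - int (c x)"] step[OF 2(1)]
      show ?thesis using col[of x] by auto
    qed
    moreover have "even (h x - csum x)" if "odd (a - b)" "\<bar>e - d\<bar> = 1" "even (e - b)" "a = csum x" "d = h x"
      for a b d e :: int using that by presburger
    ultimately show ?case by blast
  qed
  then have *: "h x mod 3 = int (c x)" "even (h x - csum x)" for x by auto
  have "h \<in> heights" unfolding heights_def using step * by (auto simp: abs_minus_commute)
  moreover have "color h = c" by (rule ext) (simp add: color_def *)
  moreover have "h 0 = 4 * int (c 0)" by (simp add: h_def)
  ultimately show ?thesis by (rule that)
qed

section \<open>Colors off the domain determine the boundary heights up to a constant\<close>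

lemma heights_step_unique:
  assumes "h \<in> heights" "h' \<in> heights" "adjacent x y" "color h x = color h' x" "color h y = color h' y"
  shows "h x - h' x = h y - h' y"
proof -
  have "(h x - h y) mod 3 = (h' x - h' y) mod 3"
    using assms(4,5) unfolding color_eq_iff by (intro mod_diff_cong)
  moreover have "\<bar>a\<bar> = 1 \<longleftrightarrow> a = 1 \<or> a = - 1" for a :: int by linarith
  ultimately have "h x - h y = h' x - h' y"
    using heights_adjacent[OF assms(1,3)] heights_adjacent[OF assms(2,3)] by auto
  then show ?thesis by simp
qed

lemma heights_unique:
  assumes "h \<in> heights" "h' \<in> heights" "color h = color h'" "h p = h' p"
  shows "h = h'"
proof
  fix x
  have "h x - h' x = h p - h' p"
  proof (induction rule: l1_induct)
    case (2 x z y)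
    then show ?case using heights_step_unique[OF assms(1,2) 2(1)] assms(3) by simp
  qed simp
  then show "h x = h' x" using assms(4) by simp
qed

text \<open>While one coordinate exceeds \<open>M\<close> in modulus, all others move freely. So all
  coordinates but \<open>i\<close> go to \<open>M + 1\<close> first; then a second one keeps the
  path outside while coordinate \<open>i\<close> follows. In dimension one the complement has two
  components.\<close>

lemma box_complement_connected:
  fixes f :: "int ^ 'd::finite \<Rightarrow> int"
  assumes d: "CARD('d) \<ge> 2"
    and f: "\<And>x y. x \<notin> lattice_box M \<Longrightarrow> y \<notin> lattice_box M \<Longrightarrow> adjacent x y \<Longrightarrow> f x = f y"
    and x: "x \<notin> lattice_box M"
  shows "f x = f (\<chi> i. int M + 1)"
proof -
  have move: "f (upd z j a) = f z" if "i \<noteq> j" "\<bar>z $ i\<bar> > int M" for z i j a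
  proof -
    have out: "upd z j k \<notin> lattice_box M" for k using that by (auto simp: lattice_box_iff not_le)
    have "f (upd z j (k + 1)) = f (upd z j k)" for k
      using f[OF out out, of k "k + 1"] adjacent_upd[of "k + 1" "upd z j k" j] by simp
    then have "f (upd z j a) = f (upd z j (z $ j))" by (rule int_const)
    then show ?thesis by simp
  qed
  obtain i where i: "\<bar>x $ i\<bar> > int M" using x by (auto simp: lattice_box_iff not_le)
  define y where "y S = (\<chi> j. if j \<in> S then int M + 1 else x $ j)" for S
  have "f (y S) = f x" if "finite S" "i \<notin> S" for S
    using that
  proof (induction S)
    case empty
    then show ?case by (simp add: y_def)
  next
    case (insert j S)
    have "y (insert j S) = upd (y S) j (int M + 1)" by (simp add: y_def vec_eq_iff)
    moreover have "\<bar>y S $ i\<bar> > int M" using i insert.prems by (simp add: y_def)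
    ultimately show ?case using move[of i j "y S" "int M + 1"] insert by auto
  qed
  from this[of "UNIV - {i}"] have 1: "f (y (UNIV - {i})) = f x" by simp
  obtain j where j: "j \<noteq> i"
  proof (rule ccontr)
    assume "\<not> thesis"
    then have "(UNIV :: 'd set) = {i}" using that by auto
    then have "CARD('d) = 1" by (metis card_1_singleton_iff One_nat_def)
    then show False using d by simp
  qed
  have "f (upd (y (UNIV - {i})) i (int M + 1)) = f (y (UNIV - {i}))"
    using j by (intro move[of j]) (auto simp: y_def)
  moreover have "upd (y (UNIV - {i})) i (int M + 1) = (\<chi> i. int M + 1)"
    by (simp add: y_def vec_eq_iff)
  ultimately show ?thesis using 1 by simp
qed

lemma lattice_box_mono: "n \<le> m \<Longrightarrow> lattice_box n \<subseteq> lattice_box m"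
  by (auto simp: lattice_box_iff) (meson of_nat_mono order_trans)

lemma finite_W [simp]: "finite (W m)"
  by (simp add: W_def)

text \<open>A site off \<open>W m\<close> has a coordinate beyond \<open>m\<close>; one step outward
  along it leaves the box of radius \<open>m + 1\<close>, whose complement is connected.\<close>

lemma W_complement_connected:
  fixes f :: "int ^ 'd::finite \<Rightarrow> int"
  assumes d: "CARD('d) \<ge> 2"
    and f: "\<And>x y. x \<notin> W m \<Longrightarrow> y \<notin> W m \<Longrightarrow> adjacent x y \<Longrightarrow> f x = f y"
    and x: "x \<notin> W m"
  shows "f x = f (\<chi> i. int m + 2)"
proof -
  have WB: "W m \<subseteq> lattice_box (m + 1)" unfolding W_def using lattice_box_mono[of m "m + 1"] by auto
  have out: "f y = f (\<chi> i. int m + 2)" if "y \<notin> lattice_box (m + 1)" for y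
  proof -
    have "f y = f (\<chi> i. int (m + 1) + 1)"
      by (rule box_complement_connected[OF d _ that]) (use f WB in blast)
    then show ?thesis by (simp add: add.commute)
  qed
  obtain i where i: "\<bar>x $ i\<bar> > int m" using x by (auto simp: lattice_box_iff not_le W_def)
  define y where "y = upd x i (x $ i + sgn (x $ i))"
  have "\<bar>y $ i\<bar> > int (m + 1)" using i by (auto simp: y_def sgn_if)
  then have y: "y \<notin> lattice_box (m + 1)" by (metis lattice_box_iff not_le)
  have "adjacent x y" unfolding y_def using i by (intro adjacent_upd) (auto simp: sgn_if)
  then have "f x = f y" using f[OF x, of y] y WB by blast
  then show ?thesis using out[OF y] by simp
qed

text \<open>Since the complement of \<open>W m\<close> is connected, a lift of a coloring that
  agrees with \<open>color h0\<close> there differs from \<open>h0\<close> by one constant. It is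
  even and divisible by 3, so removing it keeps parity and colors. A site off \<open>W m\<close>
  makes the lift unique.\<close>

lemma bij_betw_color:
  assumes d: "CARD('d::finite) \<ge> 2" and h0: "h0 \<in> heights"
  shows "bij_betw color (fillings (W m) h0) (boundary_colorings (color (h0 :: int ^ 'd \<Rightarrow> int)) m)"
  unfolding bij_betw_def
proof
  let ?p = "(\<chi> i. int m + 2) :: int ^ 'd"
  have p: "?p \<notin> W m" by (auto simp: W_def lattice_box_iff)
  show "inj_on color (fillings (W m) h0)"
    using heights_unique[of _ _ ?p] p by (intro inj_onI) (auto simp: fillings_def)
  show "color ` fillings (W m) h0 = boundary_colorings (color h0) m"
  proof
    show "color ` fillings (W m) h0 \<subseteq> boundary_colorings (color h0) m"
      using color_mem_C3 by (auto simp: fillings_def boundary_colorings_def color_def)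
    show "boundary_colorings (color h0) m \<subseteq> color ` fillings (W m) h0"
    proof
      fix c assume c: "c \<in> boundary_colorings (color h0) m"
      then have "c \<in> C3" by (simp add: boundary_colorings_def)
      then obtain h where h: "h \<in> heights" "color h = c" by (rule coloring_lift)
      have eq: "color h x = color h0 x" if "x \<notin> W m" for x
        using c that h(2) by (simp add: boundary_colorings_def)
      define t where "t = h0 ?p - h ?p"
      have t2: "even t" unfolding t_def by (rule heights_even_diff[OF h0 h(1)])
      have t3: "t mod 3 = 0" using eq[OF p] unfolding t_def color_eq_iff by presburger
      have "h x - h0 x = h ?p - h0 ?p" if "x \<notin> W m" for x
        using W_complement_connected[OF d _ that, of "\<lambda>x. h x - h0 x"] heights_step_unique[OF h(1) h0] eq
        by blast
      then have "(\<lambda>x. h x + t) \<in> fillings (W m) h0"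
        using heights_shift[OF h(1) t2] by (auto simp: fillings_def t_def algebra_simps)
      moreover have "color (\<lambda>x. h x + t) = c"
      proof
        fix x
        have "(h x + t) mod 3 = h x mod 3" using t3 by presburger
        then show "color (\<lambda>x. h x + t) x = c x" using h(2) by (auto simp: color_def)
      qed
      ultimately show "c \<in> color ` fillings (W m) h0" by blast
    qed
  qed
qed

text \<open>Odd sites need an odd height divisible by 3, for which 3 is taken; the colors 1 and 2 of
  even sites become the adjacent heights 4 and 2.\<close>

lemma flat_boundary_lift:
  fixes c0 :: "int ^ 'd::finite \<Rightarrow> nat"
  assumes c0: "c0 \<in> C3" and zero: "\<forall>v\<in>odd_vertices. c0 v = 0"
  obtains h0 where "h0 \<in> heights" "color h0 = c0" "\<And>x. h0 x \<in> {2..4}"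
proof -
  define h0 :: "int ^ 'd \<Rightarrow> int" where "h0 v = (if v \<in> odd_vertices then 3 else if c0 v = 1 then 4 else 2)" for v
  have odd: "v \<in> odd_vertices \<longleftrightarrow> odd (csum v)" for v :: "int ^ 'd" by (simp add: odd_vertices_def csum_def)
  have adj: "u \<in> odd_vertices \<longleftrightarrow> v \<notin> odd_vertices" if "adjacent u v" for u v :: "int ^ 'd"
    using l1_parity[of u v] that by (auto simp: adjacent_iff_l1 odd)
  have "c0 v \<in> {1, 2}" if "v \<notin> odd_vertices" for v
  proof -
    have a: "adjacent v (succ_coord undefined v)" by (rule adjacent_upd) simp
    then have "c0 (succ_coord undefined v) = 0" using adj[OF a] that zero by simp
    then show ?thesis using c0 a by (metis (no_types, lifting) insert_iff mem_C3_iff)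
  qed
  then have "color h0 v = c0 v" for v using zero by (auto simp: color_def h0_def)
  then have "color h0 = c0" by blast
  moreover have "h0 \<in> heights" unfolding heights_def
    using adj by (auto simp: h0_def odd)
  moreover have "h0 x \<in> {2..4}" for x by (simp add: h0_def)
  ultimately show ?thesis using that by blast
qed

subsection \<open>Flat height functions from reflected tiles\<close>

text \<open>The tile with index \<open>t\<close> is the box of radius \<open>k\<close> around \<open>2 * k * t\<close>; \<open>reflect k t\<close> folds it
  onto the box around the origin, in such a way that neighbouring tiles are mirror images.\<close>

definition tile :: "nat \<Rightarrow> int ^ 'd::finite \<Rightarrow> int ^ 'd" where
  "tile k x = (\<chi> i. (x $ i + int k) div (2 * int k))"

definition reflect :: "nat \<Rightarrow> int ^ 'd::finite \<Rightarrow> int ^ 'd \<Rightarrow> int ^ 'd" where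
  "reflect k t x = (\<chi> i. (if even (t $ i) then 1 else - 1) * (x $ i - 2 * int k * t $ i))"

definition tiled :: "nat \<Rightarrow> (int ^ 'd::finite \<Rightarrow> int ^ 'd \<Rightarrow> int) \<Rightarrow> int ^ 'd \<Rightarrow> int" where
  "tiled k \<gamma> x = \<gamma> (tile k x) (reflect k (tile k x) x)"

lemma l1_reflect: "l1 (reflect k t x) (reflect k t y) = l1 x y"
  unfolding l1_def by (intro sum.cong) (auto simp: reflect_def)

lemma csum_reflect: "even (csum (reflect k t x) - csum x)"
  unfolding csum_def sum_subtractf[symmetric] by (intro dvd_sum) (auto simp: reflect_def)

lemma tile_bounds:
  assumes "k \<ge> 1"
  shows "2 * int k * tile k x $ i - int k \<le> x $ i" "x $ i < 2 * int k * tile k x $ i + int k"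
proof -
  define q r where "q = (x $ i + int k) div (2 * int k)" and "r = (x $ i + int k) mod (2 * int k)"
  have "x $ i + int k = 2 * int k * q + r" "0 \<le> r" "r < 2 * int k"
    using assms by (simp_all add: q_def r_def)
  then show "2 * int k * tile k x $ i - int k \<le> x $ i" "x $ i < 2 * int k * tile k x $ i + int k"
    by (simp_all add: tile_def q_def[symmetric])
qed

lemma tile_unique:
  assumes "2 * int k * t - int k \<le> x $ i" "x $ i < 2 * int k * t + int k"
  shows "tile k x $ i = t"
proof -
  have "(x $ i + int k) div (2 * int k) = t"
    by (rule int_div_pos_eq[of _ _ _ "x $ i + int k - 2 * int k * t"]) (use assms in simp_all)
  then show ?thesis by (simp add: tile_def)
qed

lemma reflect_tile_mem:
  assumes "k \<ge> 1"
  shows "reflect k (tile k x) x \<in> lattice_box k"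
  unfolding lattice_box_iff
proof
  fix i
  show "\<bar>reflect k (tile k x) x $ i\<bar> \<le> int k"
    using tile_bounds[OF assms, of x i] by (auto simp: reflect_def)
qed

text \<open>Tile centres are 2k apart, so neighbouring tiles of radius \<open>k\<close> share a
  face. On it both foldings give the same point of the box boundary, where all patterns agree.
  Translated copies would instead require equal values on opposite faces.\<close>

lemma tiled_heights:
  assumes k: "k \<ge> 1" and \<gamma>: "\<And>t. \<gamma> t \<in> heights"
    and agree: "\<And>t t' x. x \<in> box_boundary k \<Longrightarrow> \<gamma> t x = \<gamma> t' x"
  shows "tiled k \<gamma> \<in> heights"
proof -
  have up: "\<bar>tiled k \<gamma> x - tiled k \<gamma> y\<bar> \<le> 1" if y: "y = succ_coord i x" for x y i
  proof -
    let ?t = "tile k x"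
    have eq: "tiled k \<gamma> y = \<gamma> ?t (reflect k ?t y)"
    proof (cases "tile k y $ i = ?t $ i")
      case True
      then have "tile k y = ?t" by (auto simp: vec_eq_iff tile_def y)
      then show ?thesis by (simp add: tiled_def)
    next
      case False
      \<comment> \<open>\<open>tile\<close> assigns a shared face to the tile of larger index, so
        the first site not assigned to the tile of \<open>x\<close> lies exactly on its
        face.\<close>
      have yi: "y $ i = 2 * int k * ?t $ i + int k"
      proof (rule ccontr)
        assume "y $ i \<noteq> 2 * int k * ?t $ i + int k"
        then have "tile k y $ i = ?t $ i"
          using tile_bounds[OF k, of x i] by (intro tile_unique) (simp_all add: y)
        then show False using False by simp
      qed
      then have ti: "tile k y $ i = ?t $ i + 1"
        using k by (intro tile_unique) (simp_all add: algebra_simps)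
      have tj: "tile k y $ j = ?t $ j" if "j \<noteq> i" for j using that by (simp add: tile_def y)
      have refl: "reflect k (tile k y) y = reflect k ?t y"
        unfolding vec_eq_iff
      proof
        fix j
        show "reflect k (tile k y) y $ j = reflect k ?t y $ j"
          using yi ti tj by (cases "j = i") (auto simp: reflect_def algebra_simps)
      qed
      have "\<bar>reflect k ?t y $ i\<bar> = int k" by (simp add: reflect_def yi)
      then have "reflect k ?t y \<in> box_boundary k"
        using reflect_tile_mem[OF k, of y] unfolding box_boundary_def refl by blast
      then show ?thesis unfolding tiled_def refl by (rule agree)
    qed
    have "l1 (reflect k ?t x) (reflect k ?t y) = 1"
      unfolding l1_reflect y by (simp add: l1_upd_same)
    then show ?thesis
      using heights_lipschitz[OF \<gamma>, of ?t "reflect k ?t x" "reflect k ?t y"] unfolding eq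
      by (simp add: tiled_def)
  qed
  show ?thesis unfolding heights_def
  proof (intro CollectI conjI allI impI)
    fix u v :: "int ^ 'a" assume "adjacent u v"
    then obtain i where i: "v = upd u i (v $ i)" "\<bar>v $ i - u $ i\<bar> = 1" by (rule adjacentE)
    have vj: "v $ j = u $ j" if "j \<noteq> i" for j using that by (subst i(1)) simp
    show "\<bar>tiled k \<gamma> u - tiled k \<gamma> v\<bar> \<le> 1"
    proof (cases "v $ i = u $ i + 1")
      case True
      from i(1) have "v = succ_coord i u" unfolding True .
      then show ?thesis by (rule up)
    next
      case False
      then have "u = succ_coord i v" using i(2) vj by (simp add: vec_eq_iff)
      then show ?thesis using up[OF \<open>u = succ_coord i v\<close>] by (simp add: abs_minus_commute)
    qed
  next
    fix v :: "int ^ 'a"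
    have "even (tiled k \<gamma> v - csum (reflect k (tile k v) v))"
      unfolding tiled_def by (rule heights_parity[OF \<gamma>])
    then show "even (tiled k \<gamma> v - csum v)" using csum_reflect[of k "tile k v" v] by presburger
  qed
qed

text \<open>Folding brings every site back to the box of radius \<open>k\<close>, so the bound does
  not grow with the tiled region. The 8 is the bound on the height at the origin.\<close>

lemma tiled_bound:
  assumes k: "k \<ge> 1" and \<gamma>: "\<And>t. \<gamma> t \<in> heights" "\<And>t. \<gamma> t 0 \<in> {0..8}"
  shows "\<bar>tiled k \<gamma> (x :: int ^ 'd::finite)\<bar> \<le> int (CARD('d) * k + 8)"
proof -
  let ?y = "reflect k (tile k x) x"
  have "\<bar>\<gamma> (tile k x) ?y - \<gamma> (tile k x) 0\<bar> \<le> int (CARD('d) * k)"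
    using heights_lipschitz[OF \<gamma>(1), of "tile k x" ?y 0] l1_0_le_lattice_box[OF reflect_tile_mem[OF k], of x]
    by linarith
  then show ?thesis using \<gamma>(2)[of "tile k x"] unfolding tiled_def by auto
qed

text \<open>An interior point of the box is unfolded into tile \<open>t\<close>. A point on a face
  might be assigned to a neighbouring tile, but there the patterns carry no information. Tiles with
  indices up to \<open>p\<close> reach out to 2kp + k.\<close>

lemma tiled_recover:
  assumes y: "y \<in> lattice_box k" "y \<notin> box_boundary k" and t: "t \<in> lattice_box p"
  obtains x where "x \<in> lattice_box (k * (2 * p + 1))" "\<And>\<gamma>. tiled k \<gamma> x = \<gamma> t y"
proof
  define x where "x = (\<chi> i. 2 * int k * t $ i + (if even (t $ i) then 1 else - 1) * y $ i)"
  have yi: "\<bar>y $ i\<bar> < int k" for i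
  proof -
    have "\<bar>y $ i\<bar> \<le> int k" "\<bar>y $ i\<bar> \<noteq> int k" using y by (auto simp: box_boundary_def lattice_box_iff)
    then show ?thesis by simp
  qed
  have "tile k x $ i = t $ i" for i
    using yi[of i] by (intro tile_unique) (auto simp: x_def)
  then have "tile k x = t" by (simp add: vec_eq_iff)
  moreover have "reflect k t x = y" by (auto simp: vec_eq_iff reflect_def x_def)
  ultimately show "tiled k \<gamma> x = \<gamma> t y" for \<gamma> by (simp add: tiled_def)
  show "x \<in> lattice_box (k * (2 * p + 1))" unfolding lattice_box_iff
  proof
    fix i
    have "\<bar>t $ i\<bar> \<le> int p" using t by (simp add: lattice_box_iff)
    then have "\<bar>2 * int k * t $ i\<bar> \<le> 2 * int k * int p" by (simp add: abs_mult mult_left_mono)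
    moreover have "\<bar>x $ i\<bar> \<le> \<bar>2 * int k * t $ i\<bar> + \<bar>y $ i\<bar>" by (auto simp: x_def)
    ultimately show "\<bar>x $ i\<bar> \<le> int (k * (2 * p + 1))" using yi[of i] by (simp add: algebra_simps)
  qed
qed

lemma card_le_fiber:
  assumes "finite X" "finite B" "f ` X \<subseteq> B" "X \<noteq> {}"
  obtains b where "card X \<le> card B * card {x \<in> X. f x = b}" "b \<in> f ` X"
proof -
  let ?c = "\<lambda>b. card {x \<in> X. f x = b}"
  have fin: "finite (f ` X)" "f ` X \<noteq> {}" using assms by auto
  have "Max (?c ` f ` X) \<in> ?c ` f ` X" using fin by (intro Max_in) auto
  then obtain b where b: "b \<in> f ` X" "?c b = Max (?c ` f ` X)" by (metis (mono_tags, lifting) imageE)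
  have bmax: "?c a \<le> ?c b" if "a \<in> f ` X" for a
    unfolding b(2) using that fin(1) by (auto intro!: Max_ge)
  have "card X = (\<Sum>a\<in>f ` X. ?c a)"
    using sum.image_gen[OF assms(1), of "\<lambda>_. 1 :: nat" f] by simp
  also have "\<dots> \<le> card (f ` X) * ?c b"
    using sum_bounded_above[of "f ` X" ?c "?c b"] bmax by simp
  also have "\<dots> \<le> card B * ?c b"
    using card_mono[OF assms(2,3)] by simp
  finally show ?thesis using b(1) that by blast
qed

text \<open>Patterns are global height functions: common boundary values permit gluing, the range at
  the origin keeps the glued function bounded, and the last clause makes \<open>card G\<close> count
  patterns on the box.\<close>

definition tile_family :: "nat \<Rightarrow> (int ^ 'd::finite \<Rightarrow> int) set \<Rightarrow> bool" where
  "tile_family k G \<longleftrightarrow> finite G \<and> G \<noteq> {} \<and> G \<subseteq> heights \<and> (\<forall>g\<in>G. g 0 \<in> {0..8}) \<and>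
     (\<forall>g\<in>G. \<forall>g'\<in>G. \<forall>x\<in>box_boundary k. g x = g' x) \<and>
     (\<forall>g\<in>G. \<forall>g'\<in>G. (\<forall>x\<in>lattice_box k. g x = g' x) \<longrightarrow> g = g')"

lemma tile_familyD:
  assumes "tile_family k G"
  shows "finite G" "G \<noteq> {}" "G \<subseteq> heights" "g \<in> G \<Longrightarrow> g 0 \<in> {0..8}"
    "g \<in> G \<Longrightarrow> g' \<in> G \<Longrightarrow> x \<in> box_boundary k \<Longrightarrow> g x = g' x"
    "g \<in> G \<Longrightarrow> g' \<in> G \<Longrightarrow> (\<And>x. x \<in> lattice_box k \<Longrightarrow> g x = g' x) \<Longrightarrow> g = g'"
  using assms unfolding tile_family_def by blast+

text \<open>Every extendable coloring has a lift with height in \<open>{0..8}\<close> at the origin,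
  which leaves at most \<open>2 * (CARD('d) * k + 8) + 1\<close> heights per boundary site. The
  lifts with the most frequent boundary values form \<open>G\<close>.\<close>

lemma large_tile_family:
  fixes k :: nat
  defines "X \<equiv> extendable_colorings (lattice_box k :: (int ^ 'd::finite) set)"
  assumes ne: "(C3 :: (int ^ 'd \<Rightarrow> nat) set) \<noteq> {}"
  obtains G :: "(int ^ 'd \<Rightarrow> int) set" where "tile_family k G"
    "card X \<le> (2 * (CARD('d) * k + 8) + 1) ^ card (box_boundary k :: (int ^ 'd) set) * card G"
proof -
  let ?\<Lambda> = "lattice_box k :: (int ^ 'd) set"
  let ?r = "int (CARD('d) * k + 8)"
  have "X \<subseteq> ?\<Lambda> \<rightarrow>\<^sub>E {0, 1, 2}" by (auto simp: X_def extendable_colorings_def proper_colorings_def)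
  moreover have "finite (?\<Lambda> \<rightarrow>\<^sub>E {0, 1, 2 :: nat})" by (intro finite_PiE) auto
  ultimately have finX: "finite X" by (rule finite_subset)
  obtain c1 where c1: "c1 \<in> (C3 :: (int ^ 'd \<Rightarrow> nat) set)" using ne by blast
  then have "restrict c1 ?\<Lambda> \<in> X"
    by (auto simp: X_def extendable_colorings_def proper_colorings_def mem_C3_iff intro!: bexI[OF _ c1])
  then have neX: "X \<noteq> {}" by blast
  have "\<exists>h. h \<in> heights \<and> h 0 \<in> {0..8} \<and> c = restrict (color h) ?\<Lambda>" if cX: "c \<in> X" for c
  proof -
    obtain \<psi> where \<psi>: "\<psi> \<in> C3" "\<forall>v\<in>?\<Lambda>. \<psi> v = c v" and c: "c \<in> proper_colorings ?\<Lambda>"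
      using cX by (auto simp: X_def extendable_colorings_def)
    obtain h where h: "h \<in> heights" "color h = \<psi>" "h 0 = 4 * int (\<psi> 0)" using \<psi>(1) by (rule coloring_lift)
    have "\<psi> 0 \<in> {0, 1, 2}" using \<psi>(1) by (simp add: mem_C3_iff)
    then have "h 0 \<in> {0..8}" using h(3) by auto
    moreover have "c = restrict (color h) ?\<Lambda>"
    proof
      fix x show "c x = restrict (color h) ?\<Lambda> x"
        using c \<psi>(2) h(2) by (cases "x \<in> ?\<Lambda>") (auto simp: proper_colorings_def PiE_def extensional_def)
    qed
    ultimately show ?thesis using h(1) by blast
  qed
  then obtain H where H: "\<And>c. c \<in> X \<Longrightarrow> H c \<in> heights" "\<And>c. c \<in> X \<Longrightarrow> H c 0 \<in> {0..8}"
    "\<And>c. c \<in> X \<Longrightarrow> c = restrict (color (H c)) ?\<Lambda>" by metis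
  let ?B = "box_boundary k :: (int ^ 'd) set"
  let ?P = "?B \<rightarrow>\<^sub>E {- ?r..?r}"
  have sub: "(\<lambda>c. restrict (H c) ?B) ` X \<subseteq> ?P"
  proof (intro image_subsetI restrict_PiE_iff[THEN iffD2] ballI)
    fix c x assume cx: "c \<in> X" "x \<in> ?B"
    then have "x \<in> ?\<Lambda>" by (simp add: box_boundary_def)
    then have "\<bar>H c x - H c 0\<bar> \<le> int (CARD('d) * k)"
      using heights_lipschitz[OF H(1)[OF cx(1)], of x 0] l1_0_le_lattice_box[of x k] by linarith
    then show "H c x \<in> {- ?r..?r}" using H(2)[OF cx(1)] by auto
  qed
  have finP: "finite ?P" by (intro finite_PiE) auto
  obtain b where b: "card X \<le> card ?P * card {c \<in> X. restrict (H c) ?B = b}"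
    "b \<in> (\<lambda>c. restrict (H c) ?B) ` X"
    using card_le_fiber[OF finX finP sub neX] .
  define Y where "Y = {c \<in> X. restrict (H c) ?B = b}"
  have "card {- int a..int a} = 2 * a + 1" for a by simp
  then have cP: "card ?P = (2 * (CARD('d) * k + 8) + 1) ^ card ?B" by (simp only: card_PiE finite_box_boundary prod_constant)
  have key: "c = c'" if "c \<in> Y" "c' \<in> Y" "\<And>x. x \<in> ?\<Lambda> \<Longrightarrow> H c x = H c' x" for c c'
  proof -
    have "restrict (color (H c)) ?\<Lambda> = restrict (color (H c')) ?\<Lambda>"
      using that(3) by (auto simp: restrict_def color_def)
    moreover have "c \<in> X" "c' \<in> X" using that(1,2) by (auto simp: Y_def)
    ultimately show ?thesis using H(3)[of c] H(3)[of c'] by argo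
  qed
  have inj: "inj_on H Y" by (intro inj_onI key) simp_all
  show ?thesis
  proof (rule that[of "H ` Y"])
    show "tile_family k (H ` Y)" unfolding tile_family_def
    proof (intro conjI ballI impI)
      show "finite (H ` Y)" using finX by (simp add: Y_def)
      show "H ` Y \<noteq> {}" using b(2) by (auto simp: Y_def)
      show "H ` Y \<subseteq> heights" using H(1) by (auto simp: Y_def)
      show "g 0 \<in> {0..8}" if "g \<in> H ` Y" for g using that H(2) by (auto simp: Y_def)
      show "g x = g' x" if g: "g \<in> H ` Y" "g' \<in> H ` Y" "x \<in> ?B" for g g' x
      proof -
        have "restrict g ?B = b" "restrict g' ?B = b" using g by (auto simp: Y_def)
        then show ?thesis using g(3) by (metis restrict_apply')
      qed
      show "g = g'" if "g \<in> H ` Y" "g' \<in> H ` Y" "\<forall>x\<in>?\<Lambda>. g x = g' x" for g g'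
        using that key by blast
    qed
    show "card X \<le> (2 * (CARD('d) * k + 8) + 1) ^ card ?B * card (H ` Y)"
      using b(1) cP card_image[OF inj] by (simp add: Y_def)
  qed
qed

subsection \<open>Counting the fillings of a box\<close>

lemma coord_le_l1: "\<bar>x $ i - y $ i\<bar> \<le> l1 x y"
  unfolding l1_def by (rule member_le_sum) auto

lemma l1_through_box:
  assumes x: "x \<in> lattice_box r" and y: "y \<notin> lattice_box n" and r: "r \<le> n"
  obtains y' where "y' \<in> lattice_box n" "l1 x y = l1 x y' + l1 y' y" "int n - int r \<le> l1 x y'"
proof
  \<comment> \<open>Clamping the coordinates of \<open>y\<close> gives a point on a geodesic from
    \<open>x\<close> to \<open>y\<close>; a coordinate of \<open>y\<close> beyond \<open>n\<close>
    puts it at distance at least \<open>n - r\<close> from \<open>x\<close>.\<close>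
  define y' where "y' = (\<chi> i. max (- int n) (min (int n) (y $ i)))"
  have xi: "\<bar>x $ i\<bar> \<le> int r" for i using x by (simp add: lattice_box_iff)
  show "y' \<in> lattice_box n" by (auto simp: lattice_box_iff y'_def)
  show "l1 x y = l1 x y' + l1 y' y" unfolding l1_def sum.distrib[symmetric]
  proof (intro sum.cong refl)
    fix i
    show "\<bar>x $ i - y $ i\<bar> = \<bar>x $ i - y' $ i\<bar> + \<bar>y' $ i - y $ i\<bar>"
      using xi[of i] r by (auto simp: y'_def max_def min_def)
  qed
  obtain i where "\<bar>y $ i\<bar> > int n" using y by (auto simp: lattice_box_iff not_le)
  then have "int n - int r \<le> \<bar>x $ i - y' $ i\<bar>" using xi[of i] r by (auto simp: y'_def max_def min_def)
  then show "int n - int r \<le> l1 x y'" using coord_le_l1[of x i y'] by linarith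
qed

text \<open>In the core \<open>h\<close> is replaced by \<open>h 0\<close> plus a tiled function,
  outside the box it is kept, and the Lipschitz extension fills the annulus. Its width is at least
  \<open>s + CARD('d) * k + 8\<close>, which absorbs the oscillation of \<open>h\<close> and the
  bound on the tiling. Each tile with index in \<open>lattice_box p\<close> chooses its pattern
  freely.\<close>

lemma card_fillings_ge:
  fixes h :: "int ^ 'd::finite \<Rightarrow> int"
  assumes k: "k \<ge> 1" and h: "h \<in> heights"
    and family: "tile_family k (G :: (int ^ 'd \<Rightarrow> int) set)"
    and s: "\<And>y. y \<in> lattice_box n \<Longrightarrow> \<bar>h y - h 0\<bar> \<le> int s"
    and n: "k * (2 * p + 1) + s + CARD('d) * k + 8 \<le> n"
  shows "card G ^ ((2 * p + 1) ^ CARD('d)) \<le> card (fillings (lattice_box n) h)"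
proof -
  note G = tile_familyD[OF family]
  let ?r = "k * (2 * p + 1)"
  let ?core = "lattice_box ?r :: (int ^ 'd) set"
  let ?\<Lambda> = "lattice_box n :: (int ^ 'd) set"
  let ?T = "lattice_box p :: (int ^ 'd) set"
  let ?f = "\<lambda>\<gamma>. tiled k \<gamma>"
  obtain g0 where g0: "g0 \<in> G" using G(2) by blast
  have core: "?core \<subseteq> ?\<Lambda>" by (rule lattice_box_mono) (use n in simp)
  have rn: "?r \<le> n" using n by simp
  have ext: "\<exists>F. F \<in> fillings ?\<Lambda> h \<and> (\<forall>x\<in>?core. F x = h 0 + ?f \<gamma> x)" if \<gamma>: "\<And>t. \<gamma> t \<in> G"
    for \<gamma> :: "int ^ 'd \<Rightarrow> int ^ 'd \<Rightarrow> int"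
  proof -
    have f: "?f \<gamma> \<in> heights"
      by (rule tiled_heights[OF k]) (use \<gamma> G(3,5) in blast)+
    have fb: "\<bar>?f \<gamma> x\<bar> \<le> int (CARD('d) * k + 8)" for x
      by (rule tiled_bound[OF k]) (use \<gamma> G(3,4) in blast)+
    have even0: "even (h 0)" using heights_parity[OF h, of 0] by (simp add: csum_def)
    define \<phi> where "\<phi> x = (if x \<in> ?core then h 0 + ?f \<gamma> x else h x)" for x
    have mixed: "\<bar>\<phi> x - \<phi> y\<bar> \<le> l1 x y" if xy: "x \<in> ?core" "y \<notin> ?\<Lambda>" for x y
    proof -
      obtain y' where y': "y' \<in> ?\<Lambda>" "l1 x y = l1 x y' + l1 y' y" "int n - int ?r \<le> l1 x y'"
        using l1_through_box[OF xy rn] .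
      have "\<phi> x - \<phi> y = ?f \<gamma> x - (h y' - h 0) + (h y' - h y)"
        using xy core by (auto simp: \<phi>_def)
      then have "\<bar>\<phi> x - \<phi> y\<bar> \<le> int (CARD('d) * k + 8) + int s + l1 y' y"
        using fb[of x] s[OF y'(1)] heights_lipschitz[OF h, of y' y] by linarith
      moreover have "int (CARD('d) * k + 8) + int s \<le> int n - int ?r" using n by linarith
      ultimately show ?thesis using y'(2,3) by linarith
    qed
    have ne: "?core \<union> - ?\<Lambda> \<noteq> {}" by (metis Un_empty emptyE zero_mem_lattice_box)
    have par: "even (\<phi> x - csum x)" for x
      using heights_parity[OF f, of x] heights_parity[OF h, of x] even0 by (auto simp: \<phi>_def)
    have lip: "\<phi> x - \<phi> y \<le> l1 x y" if xy: "x \<in> ?core \<union> - ?\<Lambda>" "y \<in> ?core \<union> - ?\<Lambda>" for x y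
    proof -
      consider "x \<in> ?core" "y \<in> ?core" | "x \<in> ?core" "y \<notin> ?\<Lambda>" | "x \<notin> ?\<Lambda>" "y \<in> ?core" | "x \<notin> ?\<Lambda>" "y \<notin> ?\<Lambda>"
        using xy by blast
      then show ?thesis
      proof cases
        case 1
        then show ?thesis using heights_lipschitz[OF f, of x y] by (simp add: \<phi>_def)
      next
        case 2
        then show ?thesis using mixed[of x y] by simp
      next
        case 3
        then show ?thesis using mixed[of y x] by (simp add: l1_commute)
      next
        case 4
        then have "x \<notin> ?core" "y \<notin> ?core" using core by auto
        then show ?thesis using heights_lipschitz[OF h, of x y] by (simp add: \<phi>_def)
      qed
    qed
    obtain F where F: "F \<in> heights" "\<And>x. x \<in> ?core \<union> - ?\<Lambda> \<Longrightarrow> F x = \<phi> x"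
      using heights_extend[OF ne par lip] by blast
    have "F \<in> fillings ?\<Lambda> h" using F core by (auto simp: fillings_def \<phi>_def)
    moreover have "\<forall>x\<in>?core. F x = h 0 + ?f \<gamma> x" using F(2) by (simp add: \<phi>_def)
    ultimately show ?thesis by blast
  qed
  define ex where "ex \<gamma> t = (if t \<in> ?T then \<gamma> t else g0)" for \<gamma> t
  have exG: "ex \<gamma> t \<in> G" if "\<gamma> \<in> ?T \<rightarrow>\<^sub>E G" for \<gamma> t
    using that g0 by (auto simp: ex_def)
  have "\<forall>\<gamma>\<in>?T \<rightarrow>\<^sub>E G. \<exists>F. F \<in> fillings ?\<Lambda> h \<and> (\<forall>x\<in>?core. F x = h 0 + ?f (ex \<gamma>) x)"
    using ext exG by blast
  from bchoice[OF this] obtain F where F: "\<And>\<gamma>. \<gamma> \<in> ?T \<rightarrow>\<^sub>E G \<Longrightarrow> F \<gamma> \<in> fillings ?\<Lambda> h"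
    "\<And>\<gamma> x. \<gamma> \<in> ?T \<rightarrow>\<^sub>E G \<Longrightarrow> x \<in> ?core \<Longrightarrow> F \<gamma> x = h 0 + ?f (ex \<gamma>) x" by blast
  have "inj_on F (?T \<rightarrow>\<^sub>E G)"
  proof (rule inj_onI)
    fix \<gamma> \<gamma>' assume g: "\<gamma> \<in> ?T \<rightarrow>\<^sub>E G" "\<gamma>' \<in> ?T \<rightarrow>\<^sub>E G" and eq: "F \<gamma> = F \<gamma>'"
    show "\<gamma> = \<gamma>'"
    proof (rule PiE_ext[OF g])
      fix t assume t: "t \<in> ?T"
      then have tG: "\<gamma> t \<in> G" "\<gamma>' t \<in> G" using g by auto
      show "\<gamma> t = \<gamma>' t"
      proof (rule G(6)[OF tG])
        fix y :: "int ^ 'd" assume y: "y \<in> lattice_box k"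
        show "\<gamma> t y = \<gamma>' t y"
        proof (cases "y \<in> box_boundary k")
          case True
          then show ?thesis by (rule G(5)[OF tG])
        next
          case False
          obtain x where x: "x \<in> ?core" "\<And>\<gamma>. tiled k \<gamma> x = \<gamma> t y"
            using tiled_recover[OF y False t] by blast
          have "?f (ex \<gamma>) x = ?f (ex \<gamma>') x"
            using F(2)[OF g(1) x(1)] F(2)[OF g(2) x(1)] eq by simp
          then show ?thesis using x(2) t by (simp add: ex_def)
        qed
      qed
    qed
  qed
  moreover have "F ` (?T \<rightarrow>\<^sub>E G) \<subseteq> fillings ?\<Lambda> h" using F(1) by blast
  ultimately have "card (?T \<rightarrow>\<^sub>E G) \<le> card (fillings ?\<Lambda> h)"
    using finite_fillings[of ?\<Lambda> h] by (intro card_inj_on_le) auto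
  then show ?thesis by (simp add: card_PiE card_lattice_box)
qed

subsection \<open>Entropy of the uniform distribution\<close>

definition uniform_prob :: "'a set \<Rightarrow> ('a \<Rightarrow> 'b) \<Rightarrow> 'b \<Rightarrow> real" where
  "uniform_prob S X a = real (card {x \<in> S. X x = a}) / real (card S)"

definition uniform_entropy :: "'a set \<Rightarrow> ('a \<Rightarrow> 'b) \<Rightarrow> real" where
  "uniform_entropy S X = - (\<Sum>a\<in>X ` S. uniform_prob S X a * ln (uniform_prob S X a))"

lemma uniform_entropy_eq_mean:
  assumes "finite S"
  shows "uniform_entropy S X = mean S (\<lambda>x. - ln (uniform_prob S X (X x)))"
proof -
  let ?p = "uniform_prob S X"
  have "(\<Sum>x\<in>S. - ln (?p (X x))) = (\<Sum>a\<in>X ` S. \<Sum>x\<in>{x \<in> S. X x = a}. - ln (?p (X x)))"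
    by (rule sum.image_gen[OF assms])
  also have "\<dots> = (\<Sum>a\<in>X ` S. - (real (card {x \<in> S. X x = a}) * ln (?p a)))"
    by (intro sum.cong refl) simp
  finally show ?thesis
    by (simp add: uniform_entropy_def mean_def uniform_prob_def sum_divide_distrib sum_negf)
qed

text \<open>Since \<open>X\<close> and \<open>Y\<close> together determine the sample point, the left-hand side is the conditional
  entropy of \<open>X\<close> given \<open>Y\<close>.\<close>

lemma uniform_entropy_ge:
  assumes S: "finite S" "S \<noteq> {}"
    and inj: "\<And>x y. x \<in> S \<Longrightarrow> y \<in> S \<Longrightarrow> X x = X y \<Longrightarrow> Y x = Y y \<Longrightarrow> x = y"
  shows "mean S (\<lambda>x. ln (real (card {x' \<in> S. Y x' = Y x}))) \<le> uniform_entropy S X"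
proof -
  let ?A = "\<lambda>x. {x' \<in> S. Y x' = Y x}" and ?B = "\<lambda>x. {x' \<in> S. X x' = X x}"
  let ?N = "\<lambda>x. real (card (?A x))" and ?p = "\<lambda>x. uniform_prob S X (X x)"
  have cS: "real (card S) > 0" using S by (simp add: card_gt_0_iff)
  have pos: "?N x > 0" "?p x > 0" if "x \<in> S" for x
  proof -
    have "x \<in> ?A x" "x \<in> ?B x" using that by auto
    then have "card (?A x) > 0" "card (?B x) > 0" using S(1) by (auto simp: card_gt_0_iff)
    then show "?N x > 0" "?p x > 0" using cS by (simp_all add: uniform_prob_def)
  qed
  \<comment> \<open>A triple (x, x', x'') with \<open>Y x' = Y x\<close> and
    \<open>X x'' = X x\<close> is determined by (x', x''), which give back \<open>Y x\<close> and
    \<open>X x\<close>. So the mean of \<open>?N x * ?p x\<close> is at most 1, and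
    \<open>ln z \<le> z - 1\<close> turns this into the entropy bound.\<close>
  have "(\<Sum>x\<in>S. card (?A x) * card (?B x)) = card (SIGMA x:S. ?A x \<times> ?B x)"
    using S(1) by (subst card_SigmaI) (auto simp: card_cartesian_product)
  also have "\<dots> \<le> card (S \<times> S)"
  proof (rule card_inj_on_le)
    show "inj_on snd (SIGMA x:S. ?A x \<times> ?B x)"
      by (intro inj_onI) (auto intro: inj)
    show "snd ` (SIGMA x:S. ?A x \<times> ?B x) \<subseteq> S \<times> S" by auto
  qed (use S in simp)
  finally have "real (\<Sum>x\<in>S. card (?A x) * card (?B x)) \<le> real (card S * card S)"
    by (simp only: card_cartesian_product of_nat_le_iff)
  then have "mean S (\<lambda>x. ?N x * ?p x) \<le> 1"
    using cS unfolding mean_def uniform_prob_def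
    by (simp add: sum_divide_distrib[symmetric] divide_le_eq)
  then have "mean S (\<lambda>x. ?N x * ?p x - 1) \<le> 0" using S by (simp add: mean_diff mean_const)
  moreover have "mean S (\<lambda>x. ln (?N x) + ln (?p x)) \<le> mean S (\<lambda>x. ?N x * ?p x - 1)"
  proof (rule mean_mono)
    fix x assume "x \<in> S"
    then show "ln (?N x) + ln (?p x) \<le> ?N x * ?p x - 1"
      using pos[of x] ln_le_minus_one[of "?N x * ?p x"] by (simp add: ln_mult)
  qed
  moreover have "mean S (\<lambda>x. ln (?N x) + ln (?p x)) = mean S (\<lambda>x. ln (?N x)) - uniform_entropy S X"
    using mean_cmult[of S "- 1" "\<lambda>x. ln (?p x)"]
    by (simp add: mean_add uniform_entropy_eq_mean[OF S(1)])
  ultimately show ?thesis by linarith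
qed

lemma mean_ge_on_subset:
  assumes S: "finite S" and f: "\<And>x. x \<in> S \<Longrightarrow> 0 \<le> f x" and c: "\<And>x. x \<in> S \<Longrightarrow> \<not> B x \<Longrightarrow> c \<le> f x"
    and bad: "mean S (\<lambda>x. if B x then 1 else 0) \<le> \<beta>" and "S \<noteq> {}" "0 \<le> c"
  shows "(1 - \<beta>) * c \<le> mean S f"
proof -
  have "(1 - \<beta>) * c \<le> (1 - mean S (\<lambda>x. if B x then 1 else 0)) * c"
    using bad \<open>0 \<le> c\<close> by (intro mult_right_mono) auto
  also have "\<dots> = mean S (\<lambda>x. c * (1 - (if B x then 1 else 0)))"
    using S \<open>S \<noteq> {}\<close> unfolding mean_cmult by (simp add: mean_diff mean_const)
  also have "\<dots> \<le> mean S f" using f c by (intro mean_mono) auto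
  finally show ?thesis .
qed

subsection \<open>Flatness of typical height functions\<close>

text \<open>A Markov quotient. Above: the sites of the box of radius \<open>n + q\<close> times the
  second moment bound. Below: the least contribution of a rough height function,
  \<open>(d * q)\<^sup>2\<close> at each site of a box of radius \<open>q\<close>.\<close>

definition rough_bound :: "nat \<Rightarrow> nat \<Rightarrow> nat \<Rightarrow> real" where
  "rough_bound d n q =
     real ((2 * (n + q) + 1) ^ d * (3 * d * (n + q) + 4)) / real ((2 * q + 1) ^ d * (d * q)\<^sup>2)"

text \<open>A deviation above 2dq at one site leaves a deviation of at least dq throughout the box
  of radius \<open>q\<close> around it, whose sites are within distance dq. That box may stick out
  of the box of radius \<open>n\<close>, hence the sum over radius \<open>n + q\<close>.\<close>

lemma rough_prob_le:
  fixes h0 :: "int ^ 'd::finite \<Rightarrow> int"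
  assumes U: "finite U" and h0: "h0 \<in> heights" and bd: "\<And>x. x \<notin> U \<Longrightarrow> h0 x \<in> {2..4}" and q: "q \<ge> 1"
  shows "mean (fillings U h0)
      (\<lambda>h. if \<exists>y\<in>lattice_box n. \<bar>h y - h 0\<bar> > int (2 * CARD('d) * q) then 1 else 0)
    \<le> rough_bound CARD('d) n q" (is "mean ?S (\<lambda>h. if ?rough h then 1 else 0) \<le> _")
proof -
  let ?d = "CARD('d)"
  let ?\<Lambda> = "lattice_box (n + q) :: (int ^ 'd) set"
  define K where "K = real ((2 * q + 1) ^ ?d * (?d * q)\<^sup>2)"
  have dq: "?d * q \<ge> 1" using q by (simp add: Suc_le_eq)
  have K: "K > 0" unfolding K_def using dq by (simp add: zero_less_power)
  have pt: "(if ?rough h then 1 else 0) \<le> (1 / K) * (\<Sum>z\<in>?\<Lambda>. (real_of_int (h z - h 0))\<^sup>2)"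
    if h: "h \<in> ?S" for h
  proof (cases "?rough h")
    case True
    then obtain y where y: "y \<in> lattice_box n" "\<bar>h y - h 0\<bar> > int (2 * ?d * q)" by blast
    let ?B = "(\<lambda>z. y + z) ` (lattice_box q :: (int ^ 'd) set)"
    have cB: "card ?B = (2 * q + 1) ^ ?d"
      by (subst card_image) (auto simp: card_lattice_box inj_on_def)
    have sub: "?B \<subseteq> ?\<Lambda>"
    proof
      fix x assume "x \<in> ?B"
      then obtain z where z: "x = y + z" "z \<in> lattice_box q" by auto
      have "\<bar>y $ i + z $ i\<bar> \<le> int n + int q" for i
      proof -
        have "\<bar>y $ i\<bar> \<le> int n" "\<bar>z $ i\<bar> \<le> int q" using y(1) z(2) by (auto simp: lattice_box_iff)
        then show ?thesis by linarith
      qed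
      then show "x \<in> ?\<Lambda>" by (simp add: lattice_box_iff z(1))
    qed
    have large: "(real (?d * q))\<^sup>2 \<le> (real_of_int (h x - h 0))\<^sup>2" if "x \<in> ?B" for x
    proof -
      obtain z where z: "x = y + z" "z \<in> lattice_box q" using \<open>x \<in> ?B\<close> by auto
      have "l1 x y = l1 z 0" by (simp add: l1_def z(1))
      then have "\<bar>h x - h y\<bar> \<le> int (?d * q)"
        using heights_lipschitz[OF fillings_heights[OF h], of x y] l1_0_le_lattice_box[OF z(2)] by linarith
      then have "int (?d * q) \<le> \<bar>h x - h 0\<bar>" using y(2) by simp
      then have "\<bar>real (?d * q)\<bar> \<le> \<bar>real_of_int (h x - h 0)\<bar>" by linarith
      then show ?thesis by (simp only: abs_le_square_iff)
    qed
    have "K = (\<Sum>x\<in>?B. (real (?d * q))\<^sup>2)" by (simp add: K_def cB)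
    also have "\<dots> \<le> (\<Sum>x\<in>?B. (real_of_int (h x - h 0))\<^sup>2)" using large by (rule sum_mono)
    also have "\<dots> \<le> (\<Sum>x\<in>?\<Lambda>. (real_of_int (h x - h 0))\<^sup>2)" using sub by (intro sum_mono2) auto
    finally show ?thesis using True K by simp
  next
    case False
    then show ?thesis using K by (simp add: sum_nonneg)
  qed
  have "mean ?S (\<lambda>h. if ?rough h then 1 else 0)
    \<le> mean ?S (\<lambda>h. (1 / K) * (\<Sum>z\<in>?\<Lambda>. (real_of_int (h z - h 0))\<^sup>2))"
    using pt by (rule mean_mono)
  also have "\<dots> = (1 / K) * mean ?S (\<lambda>h. \<Sum>z\<in>?\<Lambda>. (real_of_int (h z - h 0))\<^sup>2)"
    by (rule mean_cmult)
  also have "mean ?S (\<lambda>h. \<Sum>z\<in>?\<Lambda>. (real_of_int (h z - h 0))\<^sup>2)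
    = (\<Sum>z\<in>?\<Lambda>. mean ?S (\<lambda>h. (real_of_int (h z - h 0))\<^sup>2))"
    unfolding mean_def sum_divide_distrib by (rule sum.swap)
  also have "\<dots> \<le> (\<Sum>z\<in>?\<Lambda>. real (3 * ?d * (n + q) + 4))"
  proof (rule sum_mono)
    fix z assume "z \<in> ?\<Lambda>"
    then have "l1 z 0 \<le> int (?d * (n + q))" by (rule l1_0_le_lattice_box)
    then have "real_of_int (l1 z 0) \<le> real (?d * (n + q))" by linarith
    moreover have "mean ?S (\<lambda>h. (real_of_int (h z - h 0))\<^sup>2) \<le> 3 * real_of_int (l1 z 0) + 4"
      by (rule second_moment[OF U h0 bd])
    ultimately show "mean ?S (\<lambda>h. (real_of_int (h z - h 0))\<^sup>2) \<le> real (3 * ?d * (n + q) + 4)"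
      by (simp add: algebra_simps)
  qed
  also have "\<dots> = real ((2 * (n + q) + 1) ^ ?d * (3 * ?d * (n + q) + 4))"
    by (simp add: card_lattice_box)
  finally show ?thesis using K by (simp add: rough_bound_def K_def divide_right_mono)
qed

text \<open>The heights off the box and the colors inside determine the filling, because the lift is
  pinned at an outside site. Flat height functions have many fillings by
  \<open>card_fillings_ge\<close>; for rough ones the logarithm is bounded below by 0, which costs
  the factor \<open>1 - rough_bound\<close>.\<close>

lemma uniform_entropy_fillings_ge:
  fixes h0 :: "int ^ 'd::finite \<Rightarrow> int"
  assumes U: "finite U" and h0: "h0 \<in> heights" and bd: "\<And>x. x \<notin> U \<Longrightarrow> h0 x \<in> {2..4}"
    and nU: "lattice_box n \<subseteq> U" and kq: "k \<ge> 1" "q \<ge> 1"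
    and G: "tile_family k (G :: (int ^ 'd \<Rightarrow> int) set)"
    and n: "k * (2 * p + 1) + 2 * CARD('d) * q + CARD('d) * k + 8 \<le> n"
  shows "(1 - rough_bound CARD('d) n q) * (real ((2 * p + 1) ^ CARD('d)) * ln (real (card G)))
    \<le> uniform_entropy (fillings U h0) (\<lambda>h. restrict (color h) (lattice_box n))"
proof -
  let ?S = "fillings U h0" and ?\<Lambda> = "lattice_box n :: (int ^ 'd) set"
  let ?rough = "\<lambda>h. \<exists>y\<in>?\<Lambda>. \<bar>h y - h 0\<bar> > int (2 * CARD('d) * q)"
  note S = fillings_nonempty[OF U h0]
  have cG: "real (card G) \<ge> 1" using tile_familyD(1,2)[OF G] by (simp add: Suc_le_eq card_gt_0_iff)
  obtain x0 where x0: "x0 \<notin> ?\<Lambda>" using infinite_lattice[where 'd='d] finite_lattice_box by (metis UNIV_eq_I)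
  have fib: "{h' \<in> ?S. restrict h' (- ?\<Lambda>) = restrict h (- ?\<Lambda>)} = fillings ?\<Lambda> h" if h: "h \<in> ?S" for h
  proof -
    have "restrict h' (- ?\<Lambda>) = restrict h (- ?\<Lambda>) \<longleftrightarrow> (\<forall>v. v \<notin> ?\<Lambda> \<longrightarrow> h' v = h v)" for h'
      by (auto simp: restrict_def fun_eq_iff)
    then show ?thesis using h nU by (auto simp: fillings_def subset_iff)
  qed
  have "(1 - rough_bound CARD('d) n q) * (real ((2 * p + 1) ^ CARD('d)) * ln (real (card G)))
    \<le> mean ?S (\<lambda>h. ln (real (card {h' \<in> ?S. restrict h' (- ?\<Lambda>) = restrict h (- ?\<Lambda>)})))"
  proof (rule mean_ge_on_subset[where B = ?rough])
    fix h assume h: "h \<in> ?S"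
    have pos: "1 \<le> card (fillings ?\<Lambda> h)"
      using fillings_nonempty[OF _ fillings_heights[OF h], of ?\<Lambda>] by (simp add: Suc_le_eq card_gt_0_iff)
    then show "0 \<le> ln (real (card {h' \<in> ?S. restrict h' (- ?\<Lambda>) = restrict h (- ?\<Lambda>)}))"
      unfolding fib[OF h] by simp
    assume "\<not> ?rough h"
    then have "\<bar>h y - h 0\<bar> \<le> int (2 * CARD('d) * q)" if "y \<in> ?\<Lambda>" for y
      using that by (meson not_le)
    from card_fillings_ge[OF kq(1) fillings_heights[OF h] G this n]
    have "real (card G) ^ ((2 * p + 1) ^ CARD('d)) \<le> real (card (fillings ?\<Lambda> h))"
      by (metis of_nat_le_iff of_nat_power)
    then have "ln (real (card G) ^ ((2 * p + 1) ^ CARD('d))) \<le> ln (real (card (fillings ?\<Lambda> h)))"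
      using cG pos by (subst ln_le_cancel_iff) auto
    then show "real ((2 * p + 1) ^ CARD('d)) * ln (real (card G))
      \<le> ln (real (card {h' \<in> ?S. restrict h' (- ?\<Lambda>) = restrict h (- ?\<Lambda>)}))"
      unfolding fib[OF h] using cG by (simp add: ln_realpow)
  next
    show "mean ?S (\<lambda>h. if ?rough h then 1 else 0) \<le> rough_bound CARD('d) n q"
      by (rule rough_prob_le[OF U h0 bd kq(2)])
    show "0 \<le> real ((2 * p + 1) ^ CARD('d)) * ln (real (card G))" using cG by simp
  qed (use S in auto)
  also have "\<dots> \<le> uniform_entropy ?S (\<lambda>h. restrict (color h) ?\<Lambda>)"
  proof (rule uniform_entropy_ge[OF S])
    fix h h' assume hh: "h \<in> ?S" "h' \<in> ?S" and X: "restrict (color h) ?\<Lambda> = restrict (color h') ?\<Lambda>"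
      and Y: "restrict h (- ?\<Lambda>) = restrict h' (- ?\<Lambda>)"
    have off: "h v = h' v" if "v \<notin> ?\<Lambda>" for v using fun_cong[OF Y, of v] that by simp
    have "color h v = color h' v" for v
      using fun_cong[OF X, of v] off[of v] by (cases "v \<in> ?\<Lambda>") (auto simp: color_def)
    then show "h = h'"
      by (intro heights_unique[of _ _ x0] fillings_heights[OF hh(1)] fillings_heights[OF hh(2)] off x0) blast
  qed
  finally show ?thesis .
qed

subsection \<open>Cylinder events and weak limits\<close>

lemma space_coloring_space: "space coloring_space = C3"
  by (simp add: coloring_space_def space_measure_of_conv)

lemma cylinder_eq:
  "c1 \<in> C3 \<Longrightarrow> (\<lambda>c. restrict c \<Lambda>) -` {restrict c1 \<Lambda>} \<inter> C3 = {c \<in> C3. \<forall>v\<in>\<Lambda>. c v = c1 v}"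
proof -
  have "restrict c \<Lambda> = restrict c1 \<Lambda> \<longleftrightarrow> (\<forall>v\<in>\<Lambda>. c v = c1 v)" for c
    by (metis restrict_apply' restrict_ext)
  then show ?thesis by auto
qed

lemma cylinder_mem_sets:
  assumes "finite \<Lambda>" "c1 \<in> C3"
  shows "{c \<in> C3. \<forall>v\<in>\<Lambda>. c v = c1 v} \<in> sets coloring_space"
proof -
  have "{c \<in> C3. c v = c1 v} \<in> sets coloring_space" for v
  proof -
    have "c1 v \<in> {0, 1, 2}" using assms(2) by (simp add: mem_C3_iff)
    then have "{c \<in> C3. c v = c1 v} \<in> {{c \<in> C3. c v = i} | v i. i \<in> {0, 1, 2}}" by blast
    then show ?thesis unfolding coloring_space_def by (intro in_measure_of) auto
  qed
  then show ?thesis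
    using sets.sets_Collect_finite_All[of \<Lambda> coloring_space "\<lambda>v c. c v = c1 v"] assms(1)
    by (simp add: space_coloring_space)
qed

lemma finite_restrict_image: "finite \<Lambda> \<Longrightarrow> finite ((\<lambda>c. restrict c \<Lambda>) ` C3)"
proof -
  assume "finite \<Lambda>"
  then have "finite (\<Lambda> \<rightarrow>\<^sub>E {0, 1, 2 :: nat})" by (intro finite_PiE) auto
  moreover have "(\<lambda>c. restrict c \<Lambda>) ` C3 \<subseteq> \<Lambda> \<rightarrow>\<^sub>E {0, 1, 2}"
    by (intro image_subsetI restrict_PiE_iff[THEN iffD2]) (simp add: mem_C3_iff)
  ultimately show ?thesis by (rule finite_subset[rotated])
qed

lemma continuous_on_cylinder:
  fixes c1 :: "int ^ 'd::finite \<Rightarrow> nat"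
  assumes "finite \<Lambda>"
  shows "continuous_on C3 (indicat_real {c \<in> C3. \<forall>v\<in>\<Lambda>. c v = c1 v})"
proof -
  have "continuous_on C3 (\<lambda>c. \<Prod>v\<in>\<Lambda>. indicat_real {c1 v} (c v))"
  proof (rule continuous_on_prod)
    fix v :: "int ^ 'd"
    have "continuous_on C3 (\<lambda>c :: int ^ 'd \<Rightarrow> nat. c v)"
      by (rule continuous_on_subset[OF continuous_on_product_coordinates]) simp
    then show "continuous_on C3 (\<lambda>c. indicat_real {c1 v} (c v))"
      using continuous_on_compose[OF _ Topological_Spaces.continuous_on_discrete, of C3 "\<lambda>c. c v" "indicat_real {c1 v}"]
      by (simp add: comp_def)
  qed
  moreover have "(\<Prod>v\<in>\<Lambda>. indicat_real {c1 v} (c v)) = indicat_real {c \<in> C3. \<forall>v\<in>\<Lambda>. c v = c1 v} c"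
    if "c \<in> C3" for c
    using that assms by (auto simp: indicator_def prod_zero_iff intro!: prod.neutral)
  ultimately show ?thesis by (simp cong: continuous_on_cong)
qed

text \<open>Cylinders over finitely many sites are clopen, so their indicators are admissible test
  functions.\<close>

lemma weakly_converges_cylinder:
  assumes w: "weakly_converges \<mu>s \<mu>" and \<mu>: "sets \<mu> = sets coloring_space"
    and \<mu>s: "\<And>k. sets (\<mu>s k) = sets coloring_space" and \<Lambda>: "finite \<Lambda>" and c1: "c1 \<in> C3"
  shows "(\<lambda>k. measure (\<mu>s k) {c \<in> C3. \<forall>v\<in>\<Lambda>. c v = c1 v}) \<longlonglongrightarrow> measure \<mu> {c \<in> C3. \<forall>v\<in>\<Lambda>. c v = c1 v}"
proof -
  let ?A = "{c \<in> C3. \<forall>v\<in>\<Lambda>. c v = c1 v}"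
  have int: "integral\<^sup>L M (indicat_real ?A) = measure M ?A" if "sets M = sets coloring_space" for M
  proof -
    have "?A \<inter> space M = ?A" using sets_eq_imp_space_eq[OF that] by (auto simp: space_coloring_space)
    then show ?thesis by simp
  qed
  have "bounded (indicat_real ?A ` C3)"
    by (rule bounded_subset[of "{0, 1}"]) (auto simp: indicator_def)
  then have "(\<lambda>k. integral\<^sup>L (\<mu>s k) (indicat_real ?A)) \<longlonglongrightarrow> integral\<^sup>L \<mu> (indicat_real ?A)"
    using w continuous_on_cylinder[OF \<Lambda>, of c1] unfolding weakly_converges_def by blast
  then show ?thesis by (simp only: int \<mu> \<mu>s)
qed

lemma tendsto_mult_ln:
  fixes p :: "nat \<Rightarrow> real"
  assumes p: "p \<longlonglongrightarrow> l" and nn: "\<And>k. 0 \<le> p k"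
  shows "(\<lambda>k. p k * ln (p k)) \<longlonglongrightarrow> l * ln l"
proof (cases "l = 0")
  case False
  then have "(\<lambda>k. ln (p k)) \<longlonglongrightarrow> ln l" using p by (intro tendsto_ln) auto
  then show ?thesis using p by (intro tendsto_mult)
next
  case True
  \<comment> \<open>Only the limit 0 is delicate. With \<open>t = sqrt x\<close> the product is
    \<open>2 * t\<^sup>2 * ln t\<close>, and \<open>ln (1 / t) \<le> 1 / t - 1\<close> bounds its
    modulus by \<open>2 * t\<close>.\<close>
  have bound: "norm (x * ln x) \<le> 2 * sqrt x" if x: "0 \<le> x" "x < 1" for x :: real
  proof (cases "x = 0")
    case False
    define t where "t = sqrt x"
    have t: "0 < t" "x = t * t" using x False by (auto simp: t_def)
    have "- ln t \<le> 1 / t - 1" using ln_le_minus_one[of "1 / t"] t(1) by (simp add: ln_div)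
    then have "(t * t) * (- ln t) \<le> (t * t) * (1 / t - 1)" using t(1) by (intro mult_left_mono) auto
    also have "\<dots> \<le> t" using t(1) by (simp add: field_simps)
    finally have "- (x * ln x) \<le> 2 * t" using t by (simp add: ln_mult algebra_simps)
    moreover have "x * ln x \<le> 0" using x False by (intro mult_nonneg_nonpos) auto
    ultimately show ?thesis by (simp add: t_def)
  qed simp
  have "(\<lambda>k. 2 * sqrt (p k)) \<longlonglongrightarrow> 2 * sqrt 0" using p True by (intro tendsto_intros) auto
  then have lim: "(\<lambda>k. 2 * sqrt (p k)) \<longlonglongrightarrow> 0" by simp
  have "eventually (\<lambda>k. p k < 1) sequentially" using p True by (intro order_tendstoD) auto
  then have "eventually (\<lambda>k. norm (p k * ln (p k)) \<le> 2 * sqrt (p k)) sequentially"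
    by eventually_elim (rule bound[OF nn])
  from Lim_null_comparison[OF this lim] show ?thesis using True by simp
qed

lemma weakly_converges_entropy:
  assumes w: "weakly_converges \<mu>s \<mu>" and \<mu>: "sets \<mu> = sets coloring_space"
    and \<mu>s: "\<And>k. sets (\<mu>s k) = sets coloring_space" and \<Lambda>: "finite \<Lambda>"
  shows "(\<lambda>k. shannon_entropy (\<mu>s k) (\<lambda>c. restrict c \<Lambda>)) \<longlonglongrightarrow> shannon_entropy \<mu> (\<lambda>c. restrict c \<Lambda>)"
proof -
  have sp: "space M = C3" if "sets M = sets coloring_space" for M :: "(int ^ 'a \<Rightarrow> nat) measure"
    using sets_eq_imp_space_eq[OF that] by (simp add: space_coloring_space)
  show ?thesis
    unfolding shannon_entropy_def sp[OF \<mu>] sp[OF \<mu>s] Let_def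
  proof (intro tendsto_minus tendsto_sum tendsto_mult_ln)
    fix x assume "x \<in> (\<lambda>c. restrict c \<Lambda>) ` C3"
    then obtain c1 where c1: "c1 \<in> C3" "x = restrict c1 \<Lambda>" by blast
    show "(\<lambda>k. measure (\<mu>s k) ((\<lambda>c. restrict c \<Lambda>) -` {x} \<inter> C3))
        \<longlonglongrightarrow> measure \<mu> ((\<lambda>c. restrict c \<Lambda>) -` {x} \<inter> C3)"
      unfolding c1(2) cylinder_eq[OF c1(1)] by (rule weakly_converges_cylinder[OF w \<mu> \<mu>s \<Lambda> c1(1)])
  qed simp
qed

lemma sets_boundary_measure: "sets (boundary_measure c0 m) = sets coloring_space"
  by (simp add: boundary_measure_def)

lemma shannon_entropy_boundary_measure:
  fixes h0 :: "int ^ 'd::finite \<Rightarrow> int"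
  assumes d: "CARD('d) \<ge> 2" and h0: "h0 \<in> heights" and \<Lambda>: "finite \<Lambda>"
  shows "shannon_entropy (boundary_measure (color h0) m) (\<lambda>c. restrict c \<Lambda>)
    = uniform_entropy (fillings (W m) h0) (\<lambda>h. restrict (color h) \<Lambda>)"
proof -
  let ?S = "fillings (W m) h0" and ?\<Omega> = "boundary_colorings (color h0) m"
  let ?X = "\<lambda>h. restrict (color h) \<Lambda>" and ?Y = "\<lambda>c :: int ^ 'd \<Rightarrow> nat. restrict c \<Lambda>"
  let ?\<mu> = "boundary_measure (color h0) m"
  note bij = bij_betw_color[OF d h0, of m]
  have S: "finite ?S" "?S \<noteq> {}" using fillings_nonempty[OF finite_W h0] by auto
  have fin: "finite ?\<Omega>" using bij S(1) by (simp add: bij_betw_finite)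
  have cards: "card ?\<Omega> = card ?S" using bij_betw_same_card[OF bij] by simp
  have sub: "?\<Omega> \<subseteq> C3" by (auto simp: boundary_colorings_def)
  have sp: "space ?\<mu> = C3" by (simp add: boundary_measure_def space_coloring_space)
  have prob: "measure ?\<mu> (?Y -` {x} \<inter> C3) = uniform_prob ?S ?X x" if x: "x \<in> ?Y ` C3" for x
  proof -
    obtain c1 where c1: "c1 \<in> C3" "x = restrict c1 \<Lambda>" using x by blast
    let ?A = "?Y -` {x} \<inter> C3"
    have A: "?A \<in> sets coloring_space"
      unfolding c1(2) cylinder_eq[OF c1(1)] by (rule cylinder_mem_sets[OF \<Lambda> c1(1)])
    have "(\<lambda>c. c) \<in> measurable (uniform_count_measure ?\<Omega>) coloring_space"
      using sub by (auto simp: measurable_def space_uniform_count_measure sets_uniform_count_measure space_coloring_space)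
    then have "measure ?\<mu> ?A = measure (uniform_count_measure ?\<Omega>) ((\<lambda>c. c) -` ?A \<inter> ?\<Omega>)"
      unfolding boundary_measure_def using A by (simp add: measure_distr space_uniform_count_measure)
    also have "\<dots> = real (card {c \<in> ?\<Omega>. ?Y c = x}) / real (card ?\<Omega>)"
    proof -
      have "(\<lambda>c. c) -` ?A \<inter> ?\<Omega> = {c \<in> ?\<Omega>. ?Y c = x}" using sub by auto
      then show ?thesis using fin by (simp add: measure_uniform_count_measure)
    qed
    also have "card {c \<in> ?\<Omega>. ?Y c = x} = card {h \<in> ?S. ?X h = x}"
    proof -
      have "{c \<in> ?\<Omega>. ?Y c = x} = color ` {h \<in> ?S. ?X h = x}" using bij by (auto simp: bij_betw_def)
      moreover have "inj_on color {h \<in> ?S. ?X h = x}"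
        using bij by (auto simp: bij_betw_def intro: inj_on_subset)
      ultimately show ?thesis by (simp add: card_image)
    qed
    finally show ?thesis by (simp only: uniform_prob_def cards)
  qed
  \<comment> \<open>Patterns that no filling shows have probability 0 and contribute
    nothing.\<close>
  have "(\<Sum>x\<in>?Y ` C3. uniform_prob ?S ?X x * ln (uniform_prob ?S ?X x))
    = (\<Sum>x\<in>?X ` ?S. uniform_prob ?S ?X x * ln (uniform_prob ?S ?X x))"
  proof (rule sum.mono_neutral_right)
    show "finite (?Y ` C3)" by (rule finite_restrict_image[OF \<Lambda>])
    show "?X ` ?S \<subseteq> ?Y ` C3" using color_mem_C3 fillings_heights by blast
    show "\<forall>x\<in>?Y ` C3 - ?X ` ?S. uniform_prob ?S ?X x * ln (uniform_prob ?S ?X x) = 0"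
    proof
      fix x assume "x \<in> ?Y ` C3 - ?X ` ?S"
      then have "?X h \<noteq> x" if "h \<in> ?S" for h using that by blast
      then have "{h \<in> ?S. ?X h = x} = {}" by blast
      then show "uniform_prob ?S ?X x * ln (uniform_prob ?S ?X x) = 0" by (simp only: uniform_prob_def) simp
    qed
  qed
  then show ?thesis unfolding shannon_entropy_def uniform_entropy_def Let_def sp
    using prob by (simp cong: sum.cong)
qed

lemma extendable_colorings_eq:
  "extendable_colorings (\<Lambda> :: (int ^ 'd::finite) set) = (\<lambda>c. restrict c \<Lambda>) ` C3"
proof
  show "extendable_colorings \<Lambda> \<subseteq> (\<lambda>c. restrict c \<Lambda>) ` C3"
  proof
    fix c assume "c \<in> extendable_colorings \<Lambda>"
    then obtain \<psi> where "\<psi> \<in> C3" "\<forall>v\<in>\<Lambda>. \<psi> v = c v" "c \<in> extensional \<Lambda>"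
      by (auto simp: extendable_colorings_def proper_colorings_def PiE_def)
    then show "c \<in> (\<lambda>c. restrict c \<Lambda>) ` C3"
      by (intro image_eqI[of _ _ \<psi>]) (auto simp: restrict_def extensional_def)
  qed
  show "(\<lambda>c. restrict c \<Lambda>) ` C3 \<subseteq> extendable_colorings \<Lambda>"
  proof (rule image_subsetI)
    fix c :: "int ^ 'd \<Rightarrow> nat" assume c: "c \<in> C3"
    then have "restrict c \<Lambda> \<in> \<Lambda> \<rightarrow>\<^sub>E {0, 1, 2}"
      by (intro restrict_PiE_iff[THEN iffD2]) (simp add: mem_C3_iff)
    moreover have "\<forall>u\<in>\<Lambda>. \<forall>v\<in>\<Lambda>. adjacent u v \<longrightarrow> restrict c \<Lambda> u \<noteq> restrict c \<Lambda> v"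
      using c by (simp add: mem_C3_iff)
    ultimately have "restrict c \<Lambda> \<in> proper_colorings \<Lambda>" unfolding proper_colorings_def by blast
    then show "restrict c \<Lambda> \<in> extendable_colorings \<Lambda>"
      unfolding extendable_colorings_def using c by (auto intro!: bexI[of _ c])
  qed
qed

lemma shannon_entropy_le:
  assumes "prob_space \<mu>" and \<mu>: "sets \<mu> = sets coloring_space" and \<Lambda>: "finite \<Lambda>"
  shows "shannon_entropy \<mu> (\<lambda>c. restrict c \<Lambda>) \<le> ln (real (card (extendable_colorings \<Lambda>)))"
proof -
  interpret prob_space \<mu> by fact
  interpret information_space \<mu> "exp 1" by unfold_locales auto
  let ?X = "\<lambda>c. restrict c \<Lambda>"
  have sp: "space \<mu> = C3" using sets_eq_imp_space_eq[OF \<mu>] by (simp add: space_coloring_space)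
  have sf: "simple_function \<mu> ?X" unfolding simple_function_def sp
  proof (intro conjI ballI)
    show "finite (?X ` C3)" by (rule finite_restrict_image[OF \<Lambda>])
    fix x assume "x \<in> ?X ` C3"
    then obtain c1 where c1: "c1 \<in> C3" "x = restrict c1 \<Lambda>" by blast
    show "?X -` {x} \<inter> C3 \<in> sets \<mu>"
      unfolding c1(2) cylinder_eq[OF c1(1)] \<mu> by (rule cylinder_mem_sets[OF \<Lambda> c1(1)])
  qed
  have "simple_distributed \<mu> ?X (\<lambda>x. prob (?X -` {x} \<inter> space \<mu>))"
    using sf by (intro simple_distributedI) auto
  from entropy_le_card[OF this] shannon_entropy_eq_entropy[OF sf] show ?thesis
    by (simp add: sp extendable_colorings_eq log_def)
qed

subsection \<open>The limits\<close>

text \<open>The common limit is the supremum of \<open>a k - \<delta> k\<close>: every number below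
  it is eventually exceeded by \<open>b\<close>, while \<open>a n\<close> surpasses it by at most
  \<open>\<delta> n\<close>.\<close>

lemma squeeze_by_lower_bounds:
  fixes a b \<delta> :: "nat \<Rightarrow> real"
  assumes le: "\<And>n. b n \<le> a n" and bdd: "\<And>n. a n \<le> B" and \<delta>: "\<delta> \<longlonglongrightarrow> 0"
    and ev: "\<And>k x. k \<ge> 1 \<Longrightarrow> x < a k - \<delta> k \<Longrightarrow> eventually (\<lambda>n. x < b n) sequentially"
  obtains T where "a \<longlonglongrightarrow> T" "b \<longlonglongrightarrow> T"
proof -
  obtain D where D: "\<And>k. \<bar>\<delta> k\<bar> \<le> D"
    using Bseq_def[THEN iffD1, OF convergent_imp_Bseq[OF convergentI[OF \<delta>]]] by auto
  let ?C = "(\<lambda>k. a k - \<delta> k) ` {1..}"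
  define T where "T = Sup ?C"
  have bd: "bdd_above ?C"
  proof (rule bdd_aboveI2)
    fix k show "a k - \<delta> k \<le> B + D" using bdd[of k] D[of k] by simp
  qed
  have upper: "a n \<le> T + \<delta> n" if "n \<ge> 1" for n
  proof -
    have "a n - \<delta> n \<in> ?C" using that by auto
    then have "a n - \<delta> n \<le> T" unfolding T_def by (rule cSup_upper[OF _ bd])
    then show ?thesis by simp
  qed
  have b: "eventually (\<lambda>n. x < b n) sequentially" if "x < T" for x
  proof -
    have lt: "x < Sup ?C" and ne: "?C \<noteq> {}" using \<open>x < T\<close> by (auto simp only: T_def)
    obtain z where z: "z \<in> ?C" "x < z" using less_cSupE[OF lt ne] .
    then obtain k where "k \<ge> 1" "x < a k - \<delta> k" by auto
    then show ?thesis by (rule ev)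
  qed
  have a: "eventually (\<lambda>n. a n < x) sequentially" if "T < x" for x
  proof -
    have "eventually (\<lambda>n. \<delta> n < x - T) sequentially" using \<delta> that by (intro order_tendstoD) auto
    then show ?thesis using eventually_ge_at_top[of 1] by eventually_elim (use upper in fastforce)
  qed
  have "a \<longlonglongrightarrow> T"
  proof (rule order_tendstoI)
    fix x assume "x < T"
    from b[OF this] show "eventually (\<lambda>n. x < a n) sequentially"
      by eventually_elim (use le in \<open>auto intro: less_le_trans\<close>)
  qed (rule a)
  moreover have "b \<longlonglongrightarrow> T"
  proof (rule order_tendstoI)
    fix x assume "T < x"
    from a[OF this] show "eventually (\<lambda>n. b n < x) sequentially"
      by eventually_elim (use le in \<open>auto intro: le_less_trans\<close>)
  qed (rule b)
  ultimately show ?thesis by (rule that)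
qed

text \<open>With \<open>q\<close> a fixed fraction of \<open>n\<close>, the volumes cancel up to a
  constant, and a linear second moment against \<open>q\<^sup>2\<close> leaves one factor
  \<open>1 / q\<close>.\<close>

lemma rough_bound_le:
  assumes "d \<ge> 1" "R \<ge> 1" "q = n div R" "q \<ge> 1"
  shows "rough_bound d n q \<le> real ((2 * R + 1) ^ d * (3 * d * (2 * R + 1) + 4)) / real q"
proof -
  have "n < R * (q + 1)" using assms(2) unfolding assms(3)
    by (metis Suc_eq_plus1 dividend_less_times_div less_eq_Suc_le mult.commute mult_Suc_right One_nat_def)
  then have n: "n \<le> 2 * R * q" using assms(2,4)
    by (smt (verit) distrib_left less_or_eq_imp_le mult.assoc mult_2 mult_le_mono2 nat_mult_1_right add_le_mono le_trans)
  have n2: "2 * n \<le> 2 * R * (q + 1)" using \<open>n < R * (q + 1)\<close> by simp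
  have 1: "2 * (n + q) + 1 \<le> (2 * R + 1) * (2 * q + 1)"
    using n2 n assms(4) by (simp add: algebra_simps)
  have 2: "3 * d * (n + q) + 4 \<le> (3 * d * (2 * R + 1) + 4) * q"
  proof -
    have "n + q \<le> (2 * R + 1) * q" using n by (simp add: algebra_simps)
    then have "3 * d * (n + q) \<le> 3 * d * ((2 * R + 1) * q)" by (rule mult_le_mono2)
    moreover have "(3 * d * (2 * R + 1) + 4) * q = 3 * d * ((2 * R + 1) * q) + 4 * q"
      by (simp add: algebra_simps)
    ultimately show ?thesis using assms(4) by linarith
  qed
  have 3: "(2 * q + 1) ^ d * q\<^sup>2 \<le> (2 * q + 1) ^ d * (d * q)\<^sup>2"
    using assms(1) by (intro mult_le_mono2 power_mono) auto
  have pos: "0 < (2 * q + 1) ^ d * q\<^sup>2" using assms(4) by simp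
  have "rough_bound d n q \<le> real (((2 * R + 1) * (2 * q + 1)) ^ d * ((3 * d * (2 * R + 1) + 4) * q)) /
      real ((2 * q + 1) ^ d * q\<^sup>2)"
    unfolding rough_bound_def
  proof (rule frac_le)
    show "real ((2 * (n + q) + 1) ^ d * (3 * d * (n + q) + 4))
      \<le> real (((2 * R + 1) * (2 * q + 1)) ^ d * ((3 * d * (2 * R + 1) + 4) * q))"
      unfolding of_nat_le_iff by (intro mult_le_mono power_mono 1 2) simp
  qed (use 3 pos in \<open>simp_all only: of_nat_le_iff of_nat_0_less_iff of_nat_0_le_iff\<close>)
  also have "\<dots> = real ((2 * R + 1) ^ d * (3 * d * (2 * R + 1) + 4)) / real q"
  proof -
    have "(A * B) ^ d * (C * x) / (B ^ d * x\<^sup>2) = A ^ d * C / x" if "B > 0" "x > 0" for A B C x :: real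
      using that by (simp add: power_mult_distrib power2_eq_square)
    from this[of "real (2 * q + 1)" "real q"] show ?thesis
      using assms(4) by (simp only: of_nat_mult of_nat_power of_nat_0_less_iff)
  qed
  finally show ?thesis .
qed

text \<open>The logarithm of the pigeonhole factor in \<open>large_tile_family\<close>, with the
  exponent estimated by \<open>card_box_boundary_le\<close>, divided by the volume
  \<open>(2 * k + 1) ^ d\<close>.\<close>

definition tile_loss :: "nat \<Rightarrow> nat \<Rightarrow> real" where
  "tile_loss d k = 2 * real d * ln (real (2 * (d * k + 8) + 1)) / real (2 * k + 1)"

lemma tile_loss_tendsto_0:
  assumes "d \<ge> 1"
  shows "tile_loss d \<longlonglongrightarrow> 0"
proof -
  have d: "real d > 0" using assms by simp
  have "(\<lambda>k. 2 * real d * ln (2 * (real d * real k + 8) + 1) / (2 * real k + 1)) \<longlonglongrightarrow> 0"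
    using d by real_asymp
  then show ?thesis by (simp add: tile_loss_def[abs_def] add_ac)
qed

lemma card_extendable_colorings_le:
  "card (extendable_colorings (lattice_box n :: (int ^ 'd::finite) set)) \<le> 3 ^ card (lattice_box n :: (int ^ 'd) set)"
proof -
  let ?\<Lambda> = "lattice_box n :: (int ^ 'd) set"
  have "extendable_colorings ?\<Lambda> \<subseteq> ?\<Lambda> \<rightarrow>\<^sub>E {0, 1, 2}"
    by (auto simp: extendable_colorings_def proper_colorings_def)
  moreover have "finite (?\<Lambda> \<rightarrow>\<^sub>E {0, 1, 2 :: nat})" by (intro finite_PiE) auto
  ultimately have "card (extendable_colorings ?\<Lambda>) \<le> card (?\<Lambda> \<rightarrow>\<^sub>E {0, 1, 2 :: nat})" by (intro card_mono)
  moreover have "card {0, 1, 2 :: nat} = 3" by simp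
  ultimately show ?thesis by (simp only: card_PiE finite_lattice_box prod_constant)
qed

lemma topo_entropy_seq_le:
  assumes "(C3 :: (int ^ 'd::finite \<Rightarrow> nat) set) \<noteq> {}"
  shows "topo_entropy_seq TYPE('d) n \<le> ln 3"
proof -
  let ?\<Lambda> = "lattice_box n :: (int ^ 'd) set"
  have "card (extendable_colorings ?\<Lambda>) > 0"
    using assms finite_restrict_image[OF finite_lattice_box, of n, where 'a='d]
    unfolding extendable_colorings_eq by (auto simp: card_gt_0_iff)
  then have "ln (real (card (extendable_colorings ?\<Lambda>))) \<le> ln (real (3 ^ card ?\<Lambda>))"
    using card_extendable_colorings_le[of n, where 'd='d] by (subst ln_le_cancel_iff) (auto simp del: of_nat_power)
  also have "\<dots> = real (card ?\<Lambda>) * ln 3" by (simp add: ln_realpow)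
  finally show ?thesis by (simp add: topo_entropy_seq_def card_lattice_box divide_le_eq mult.commute)
qed

lemma ln_card_tile_family:
  assumes ne: "(C3 :: (int ^ 'd::finite \<Rightarrow> nat) set) \<noteq> {}" and k: "k \<ge> 1"
  obtains G :: "(int ^ 'd \<Rightarrow> int) set" where "tile_family k G"
    "real ((2 * k + 1) ^ CARD('d)) * (topo_entropy_seq TYPE('d) k - tile_loss CARD('d) k) \<le> ln (real (card G))"
proof -
  let ?d = "CARD('d)" and ?X = "extendable_colorings (lattice_box k :: (int ^ 'd) set)"
  let ?b = "2 * (?d * k + 8) + 1" and ?e = "card (box_boundary k :: (int ^ 'd) set)"
  obtain G :: "(int ^ 'd \<Rightarrow> int) set" where G: "tile_family k G" "card ?X \<le> ?b ^ ?e * card G"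
    using large_tile_family[OF ne, of k] .
  have X: "card ?X > 0"
    using ne finite_restrict_image[OF finite_lattice_box, of k, where 'a='d]
    unfolding extendable_colorings_eq by (auto simp: card_gt_0_iff)
  have cG: "card G > 0" using tile_familyD(1,2)[OF G(1)] by (simp add: card_gt_0_iff)
  have dpos: "?d \<ge> 1" by (simp add: Suc_le_eq)
  have lnb: "ln (real ?b) \<ge> 0" by simp
  have "ln (real (card ?X)) \<le> ln (real (?b ^ ?e * card G))"
    using X G(2) cG by (subst ln_le_cancel_iff) (auto simp del: of_nat_mult of_nat_power)
  also have "\<dots> = ln (real ?b ^ ?e) + ln (real (card G))"
  proof -
    have "0 < real ?b" by (rule of_nat_0_less_iff[THEN iffD2]) simp
    then show ?thesis using cG unfolding of_nat_mult of_nat_power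
      by (intro ln_mult_pos zero_less_power) simp_all
  qed
  also have "ln (real ?b ^ ?e) = real ?e * ln (real ?b)"
    by (rule ln_realpow)
  finally have 1: "ln (real (card ?X)) \<le> real ?e * ln (real ?b) + ln (real (card G))" .
  have "real ?e * ln (real ?b) \<le> real (2 * ?d * (2 * k + 1) ^ (?d - 1)) * ln (real ?b)"
    using card_box_boundary_le[of k, where 'd='d] lnb by (intro mult_right_mono) (simp_all only: of_nat_le_iff)
  also have "\<dots> = real ((2 * k + 1) ^ ?d) * tile_loss ?d k"
  proof -
    have "(2 * k + 1) ^ ?d = (2 * k + 1) * (2 * k + 1) ^ (?d - 1)"
      using dpos by (metis One_nat_def Suc_pred power_Suc less_eq_Suc_le)
    then have "real ((2 * k + 1) ^ ?d) = real (2 * k + 1) * real ((2 * k + 1) ^ (?d - 1))"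
      by (simp only: of_nat_mult)
    then show ?thesis unfolding tile_loss_def by (simp only: of_nat_mult) simp
  qed
  finally have 2: "real ?e * ln (real ?b) \<le> real ((2 * k + 1) ^ ?d) * tile_loss ?d k" .
  have "real ((2 * k + 1) ^ ?d) * topo_entropy_seq TYPE('d) k = ln (real (card ?X))"
    by (simp add: topo_entropy_seq_def card_lattice_box)
  then show ?thesis using 1 2 G(1) that by (simp add: right_diff_distrib)
qed

lemma measure_entropy_seq_nonneg:
  assumes "prob_space \<mu>"
  shows "0 \<le> measure_entropy_seq \<mu> n"
proof -
  interpret prob_space \<mu> by fact
  have "(\<Sum>x\<in>(\<lambda>c. restrict c (lattice_box n)) ` space \<mu>.
      let p = prob ((\<lambda>c. restrict c (lattice_box n)) -` {x} \<inter> space \<mu>) in p * ln p) \<le> 0"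
    unfolding Let_def
  proof (rule sum_nonpos)
    fix x
    define p where "p = prob ((\<lambda>c. restrict c (lattice_box n)) -` {x} \<inter> space \<mu>)"
    have "0 \<le> p" "p \<le> 1" by (simp_all add: p_def)
    then have "p * ln p \<le> 0" by (cases "p = 0") (auto intro!: mult_nonneg_nonpos)
    then show "prob ((\<lambda>c. restrict c (lattice_box n)) -` {x} \<inter> space \<mu>) *
      ln (prob ((\<lambda>c. restrict c (lattice_box n)) -` {x} \<inter> space \<mu>)) \<le> 0" by (simp add: p_def)
  qed
  then show ?thesis
    by (simp add: measure_entropy_seq_def shannon_entropy_def divide_nonpos_nonneg)
qed

lemma measure_entropy_seq_ge:
  fixes c0 :: "int ^ 'd::finite \<Rightarrow> nat" and \<mu> :: "(int ^ 'd \<Rightarrow> nat) measure"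
  assumes d: "CARD('d) \<ge> 2" and c0: "c0 \<in> C3" "\<forall>v\<in>odd_vertices. c0 v = 0"
    and \<mu>: "subsequential_weak_limit (boundary_measure c0) \<mu>"
    and kq: "k \<ge> 1" "q \<ge> 1" and G: "tile_family k (G :: (int ^ 'd \<Rightarrow> int) set)"
    and n: "k * (2 * p + 1) + 2 * CARD('d) * q + CARD('d) * k + 8 \<le> n"
  shows "(1 - rough_bound CARD('d) n q) * (real ((2 * p + 1) ^ CARD('d)) * ln (real (card G)))
    / real ((2 * n + 1) ^ CARD('d)) \<le> measure_entropy_seq \<mu> n"
proof -
  let ?L = "(1 - rough_bound CARD('d) n q) * (real ((2 * p + 1) ^ CARD('d)) * ln (real (card G)))"
  let ?Y = "\<lambda>c :: int ^ 'd \<Rightarrow> nat. restrict c (lattice_box n)"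
  obtain h0 where h0: "h0 \<in> heights" "color h0 = c0" "\<And>x. h0 x \<in> {2..4}"
    using flat_boundary_lift[OF c0] by metis
  obtain r where r: "strict_mono r" "weakly_converges (boundary_measure c0 \<circ> r) \<mu>"
    and sets: "sets \<mu> = sets coloring_space"
    using \<mu> by (auto simp: subsequential_weak_limit_def)
  have lim: "(\<lambda>j. shannon_entropy ((boundary_measure c0 \<circ> r) j) ?Y) \<longlonglongrightarrow> shannon_entropy \<mu> ?Y"
    by (rule weakly_converges_entropy[OF r(2) sets]) (simp_all add: sets_boundary_measure)
  \<comment> \<open>For \<open>j \<ge> n\<close> the box lies in \<open>W (r j)\<close>; the bound
    is independent of \<open>j\<close> and so survives the limit.\<close>
  have "?L \<le> shannon_entropy ((boundary_measure c0 \<circ> r) j) ?Y" if "j \<ge> n" for j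
  proof -
    have "n \<le> r j" using seq_suble[OF r(1), of j] that by simp
    then have "(lattice_box n :: (int ^ 'd) set) \<subseteq> W (r j)"
      unfolding W_def using lattice_box_mono[of n "r j"] by blast
    from uniform_entropy_fillings_ge[OF finite_W h0(1) h0(3) this kq G n]
      shannon_entropy_boundary_measure[OF d h0(1), of "lattice_box n" "r j"]
    show ?thesis by (simp add: h0(2))
  qed
  then have "?L \<le> shannon_entropy \<mu> ?Y" by (intro LIMSEQ_le_const[OF lim]) blast
  then show ?thesis
    by (simp add: measure_entropy_seq_def card_lattice_box divide_right_mono)
qed

text \<open>The tile radius \<open>k\<close> is fixed first, then \<open>R\<close>, and only then
  does \<open>n\<close> grow. Roughness is measured on the scale \<open>q = n div R\<close>; its
  margin 2dq costs the fraction 2d/R of the radius, which a large \<open>R\<close> makes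
  harmless.\<close>

lemma eventually_measure_entropy_seq_gt:
  fixes c0 :: "int ^ 'd::finite \<Rightarrow> nat" and \<mu> :: "(int ^ 'd \<Rightarrow> nat) measure"
  assumes d: "CARD('d) \<ge> 2" and c0: "c0 \<in> C3" "\<forall>v\<in>odd_vertices. c0 v = 0"
    and \<mu>: "subsequential_weak_limit (boundary_measure c0) \<mu>" and k: "k \<ge> 1"
    and x: "x < topo_entropy_seq TYPE('d) k - tile_loss CARD('d) k"
  shows "eventually (\<lambda>n. x < measure_entropy_seq \<mu> n) sequentially"
proof (cases "x < 0")
  case True
  have "prob_space \<mu>" using \<mu> by (simp add: subsequential_weak_limit_def)
  then have "x < measure_entropy_seq \<mu> n" for n
    using measure_entropy_seq_nonneg[of \<mu> n] True by simp
  then show ?thesis by simp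
next
  case False
  let ?d = "CARD('d)"
  define c where "c = topo_entropy_seq TYPE('d) k - tile_loss ?d k"
  \<comment> \<open>A nonnegative \<open>x\<close> below \<open>c\<close> makes \<open>c\<close>
    positive, so multiplying by \<open>c\<close> preserves inequalities; negative \<open>x\<close>
    are treated apart for this reason.\<close>
  have c: "0 \<le> x" "x < c" using False x by (auto simp: c_def)
  have ne: "(C3 :: (int ^ 'd \<Rightarrow> nat) set) \<noteq> {}" using c0(1) by blast
  obtain G :: "(int ^ 'd \<Rightarrow> int) set" where G: "tile_family k G"
    "real ((2 * k + 1) ^ ?d) * c \<le> ln (real (card G))"
    using ln_card_tile_family[OF ne k] unfolding c_def by blast
  have "(\<lambda>R. (1 - 2 * real ?d / real R) ^ ?d * c) \<longlonglongrightarrow> (1 - 0) ^ ?d * c"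
    by (intro tendsto_intros lim_const_over_n)
  then have "eventually (\<lambda>R. x < (1 - 2 * real ?d / real R) ^ ?d * c) sequentially"
    using c(2) by (intro order_tendstoD) auto
  moreover have "eventually (\<lambda>R. R > 2 * ?d) sequentially" by (rule eventually_gt_at_top)
  ultimately obtain R where R: "R > 2 * ?d" "x < (1 - 2 * real ?d / real R) ^ ?d * c"
    by (metis (mono_tags, lifting) eventually_conj eventually_happens trivial_limit_sequentially)
  define \<theta> where "\<theta> = 1 - 2 * real ?d / real R"
  define A where "A = real ((2 * R + 1) ^ ?d * (3 * ?d * (2 * R + 1) + 4))"
  \<comment> \<open>The fixed losses: dk + 8 from the annulus and at most 2k from rounding
    \<open>p\<close>.\<close>
  define K where "K = real (?d * k + 8 + 2 * k)"
  define L where "L n = (1 - A / real (n div R)) * ((2 * (\<theta> * real n - K)) / (2 * real n + 1)) ^ ?d * c" for n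
  have Rpos: "R > 0" using R(1) by simp
  have div: "filterlim (\<lambda>n. n div R) at_top sequentially"
    unfolding filterlim_at_top
  proof
    fix Z
    show "eventually (\<lambda>n. Z \<le> n div R) sequentially"
      using eventually_ge_at_top[of "Z * R"] by eventually_elim (use Rpos in \<open>simp add: less_eq_div_iff_mult_less_eq\<close>)
  qed
  have "(\<lambda>n. A / real (n div R)) \<longlonglongrightarrow> 0"
    using filterlim_compose[OF lim_const_over_n div, of A] by simp
  moreover have "(\<lambda>n. (2 * (\<theta> * real n - K)) / (2 * real n + 1)) \<longlonglongrightarrow> \<theta>" by real_asymp
  ultimately have "L \<longlonglongrightarrow> (1 - 0) * \<theta> ^ ?d * c" unfolding L_def[abs_def] by (intro tendsto_intros)
  then have ev_L: "eventually (\<lambda>n. x < L n) sequentially"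
    using R(2) unfolding \<theta>_def[symmetric] by (intro order_tendstoD) auto
  have \<theta>: "\<theta> > 0" using R(1) unfolding \<theta>_def by simp
  \<comment> \<open>\<open>q \<ge> A\<close> keeps \<open>1 - A / q\<close> nonnegative for the
    product estimate at the end.\<close>
  have ev_q: "eventually (\<lambda>n. max 1 (nat \<lceil>A\<rceil>) \<le> n div R) sequentially"
    using div unfolding filterlim_at_top by blast
  have ev_n: "eventually (\<lambda>n. real n \<ge> (K + 2 * real k) / \<theta>) sequentially"
    using filterlim_real_sequentially unfolding filterlim_at_top by blast
  show ?thesis using ev_L ev_q ev_n
  proof eventually_elim
    case (elim n)
    define q where "q = n div R"
    define M where "M = n - (2 * ?d * q + ?d * k + 8)"
    \<comment> \<open>The largest \<open>p\<close> with \<open>k * (2 * p + 1) \<le> M\<close>,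
      where \<open>M\<close> is the radius left for the core.\<close>
    define p where "p = (M - k) div (2 * k)"
    have q1: "q \<ge> 1" and qA: "real q \<ge> A" using elim(2) unfolding q_def by linarith+
    have "real (q * R) \<le> real n" unfolding q_def of_nat_le_iff by (rule div_times_less_eq_dividend)
    then have "real q \<le> real n / real R" using Rpos by (simp add: le_divide_eq)
    then have "2 * real ?d * real q \<le> 2 * real ?d * (real n / real R)" by (intro mult_left_mono) auto
    then have qn: "\<theta> * real n \<le> real n - 2 * real ?d * real q" by (simp add: \<theta>_def algebra_simps)
    have nK: "K + 2 * real k \<le> \<theta> * real n" using elim(3) \<theta> by (simp add: divide_le_eq mult.commute)
    have n1: "real (2 * ?d * q + ?d * k + 8) + 4 * real k \<le> real n"
      using qn nK unfolding K_def by simp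
    then have n1': "2 * ?d * q + ?d * k + 8 + 4 * k \<le> n" by linarith
    then have M: "M \<ge> k" "real M = real n - real (2 * ?d * q + ?d * k + 8)" unfolding M_def by (auto simp: of_nat_diff)
    have "2 * k * p \<le> M - k" unfolding p_def by (rule times_div_less_eq_dividend)
    then have upper: "k * (2 * p + 1) \<le> M" using M(1) by (simp add: algebra_simps)
    have lower: "M - k < 2 * k * (p + 1)"
      unfolding p_def using k dividend_less_times_div[of "2 * k" "M - k"] by (simp add: algebra_simps)
    have fit: "k * (2 * p + 1) + 2 * ?d * q + ?d * k + 8 \<le> n"
      using upper n1' unfolding M_def by linarith
    have "real M < real k * real (2 * p + 1) + 2 * real k"
    proof -
      have "M < k * (2 * p + 1) + 2 * k" using lower M(1) by (simp add: algebra_simps)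
      then show ?thesis by (metis of_nat_add of_nat_less_iff of_nat_mult of_nat_numeral)
    qed
    then have pk: "\<theta> * real n - K \<le> real k * real (2 * p + 1)"
      using qn M(2) unfolding K_def by simp
    let ?t = "2 * (\<theta> * real n - K) / (2 * real n + 1)"
    have t0: "0 \<le> ?t" using nK by simp
    have "?t \<le> real ((2 * p + 1) * (2 * k + 1)) / real (2 * n + 1)"
    proof -
      \<comment> \<open>Tiles advance by 2k, while patterns live on 2k + 1 sites per direction; the
        overlap works in favour of the estimate.\<close>
      have "2 * (\<theta> * real n - K) \<le> real (2 * p + 1) * (2 * real k)" using pk by (simp add: algebra_simps)
      also have "\<dots> \<le> real (2 * p + 1) * real (2 * k + 1)" by (intro mult_left_mono) auto
      finally have "2 * (\<theta> * real n - K) \<le> real ((2 * p + 1) * (2 * k + 1))" by (simp only: of_nat_mult)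
      moreover have "real (2 * n + 1) = 2 * real n + 1" by simp
      ultimately show ?thesis by (simp only: divide_right_mono add_nonneg_nonneg of_nat_0_le_iff zero_le_one)
    qed
    then have "?t ^ ?d \<le> (real ((2 * p + 1) * (2 * k + 1)) / real (2 * n + 1)) ^ ?d"
      using t0 by (rule power_mono)
    also have "\<dots> = real ((2 * p + 1) ^ ?d) * real ((2 * k + 1) ^ ?d) / real ((2 * n + 1) ^ ?d)"
      by (simp only: power_divide of_nat_mult of_nat_power power_mult_distrib)
    finally have t: "?t ^ ?d * c \<le> real ((2 * p + 1) ^ ?d) * real ((2 * k + 1) ^ ?d) / real ((2 * n + 1) ^ ?d) * c"
      using c by (intro mult_right_mono) auto
    also have "\<dots> = real ((2 * p + 1) ^ ?d) * (real ((2 * k + 1) ^ ?d) * c) / real ((2 * n + 1) ^ ?d)"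
      by simp
    also have "\<dots> \<le> real ((2 * p + 1) ^ ?d) * ln (real (card G)) / real ((2 * n + 1) ^ ?d)"
      using G(2) by (intro divide_right_mono mult_left_mono) auto
    finally have main: "?t ^ ?d * c \<le> real ((2 * p + 1) ^ ?d) * ln (real (card G)) / real ((2 * n + 1) ^ ?d)" .
    have rough: "rough_bound ?d n q \<le> A / real q"
      unfolding A_def using R(1) d q1 by (intro rough_bound_le) (auto simp: q_def)
    have "A / real q \<le> 1" using qA q1 by (simp add: divide_le_eq)
    then have "L n \<le> (1 - A / real q) * (real ((2 * p + 1) ^ ?d) * ln (real (card G)) / real ((2 * n + 1) ^ ?d))"
      using main unfolding L_def q_def[symmetric] mult.assoc by (intro mult_left_mono) auto
    also have "\<dots> \<le> (1 - rough_bound ?d n q) * (real ((2 * p + 1) ^ ?d) * ln (real (card G)) / real ((2 * n + 1) ^ ?d))"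
    proof (rule mult_right_mono)
      have "0 \<le> ?t ^ ?d * c" using t0 c by simp
      then show "0 \<le> real ((2 * p + 1) ^ ?d) * ln (real (card G)) / real ((2 * n + 1) ^ ?d)" using main by linarith
    qed (use rough in simp)
    also have "\<dots> \<le> measure_entropy_seq \<mu> n"
      using measure_entropy_seq_ge[OF d c0 \<mu> k q1 G(1) fit] by simp
    finally show ?case using elim(1) by simp
  qed
qed

theorem theorem1p2:
  fixes c\<^sub>0 :: "int ^ 'd::finite \<Rightarrow> nat" and \<mu> :: "(int ^ 'd \<Rightarrow> nat) measure"
  assumes "CARD('d) \<ge> 2"
    and "c\<^sub>0 \<in> C3"
    and "\<forall>v\<in>odd_vertices. c\<^sub>0 v = 0"
    and "subsequential_weak_limit (boundary_measure c\<^sub>0) \<mu>"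
  shows "maximal_entropy \<mu>"
proof -
  have \<mu>: "prob_space \<mu>" "sets \<mu> = sets coloring_space"
    using assms(4) by (simp_all add: subsequential_weak_limit_def)
  have ne: "(C3 :: (int ^ 'd \<Rightarrow> nat) set) \<noteq> {}" using assms(2) by blast
  have le: "measure_entropy_seq \<mu> n \<le> topo_entropy_seq TYPE('d) n" for n
    unfolding measure_entropy_seq_def topo_entropy_seq_def
    by (intro divide_right_mono shannon_entropy_le[OF \<mu>]) simp_all
  have "CARD('d) \<ge> 1" using assms(1) by simp
  note loss = tile_loss_tendsto_0[OF this]
  obtain T where T: "topo_entropy_seq TYPE('d) \<longlonglongrightarrow> T" "measure_entropy_seq \<mu> \<longlonglongrightarrow> T"
    using squeeze_by_lower_bounds[where a = "topo_entropy_seq TYPE('d)" and b = "measure_entropy_seq \<mu>",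
      OF le topo_entropy_seq_le[OF ne] loss eventually_measure_entropy_seq_gt[OF assms]] .
  then show ?thesis
    unfolding maximal_entropy_def measure_entropy_def topo_entropy_def
    by (auto simp: convergentI limI)
qed

end
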